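(* Let $W$ be a finite simply-laced Coxeter group (a Weyl group of type $A$, $D$ or $E$). Let $x<y$ in $W$ and let $t$ be a minimal reflection for $(x,y)$. Then there exists a maximal chain \[x=z_0\lessdot z_1\lessdot\cdots\lessdot z_{\ell(y)-\ell(x)-1}=yt\] such that $z_it\in[x,y]$ and $z_it\gtrdot z_i$ for all $0\le i\le \ell(y)-\ell(x)-1$.
   Context: Let $(W,S)$ be a finite Coxeter system which is simply-laced, i.e. the order $m_{st}$ of $st$ is at most $3$ for all $s,t\in S$. $\ell$ is the length function, $\le$ the Bruhat order, $[x,y]=\{z: x\le z\le y\}$, and $x\lessdot y$ (equivalently $y\gtrdot x$) means $x<y$ and $\ell(y)=\ell(x)+1$. $T=\bigcup_{w\in W}wSw^{-1}$ is the set of reflections. Let $\{\alpha_s\}_{s\in S}$ be the simple roots in the (dual of the) geometric representation, $\Phi=\{w(\alpha_s): w\in W, s\in S\}$ the roots, $\Phi^+$ the positive roots; for $t\in T$ let $\alpha_t\in\Phi^+$ be the positive root corresponding to $t$ (if $t=wsw^{-1}$ with $s\in S$, $ws>w$, then $\alpha_t=w(\alpha_s)$). Partial order on $\Phi^+$: $\alpha\succ\beta$ if $\alpha-\beta$ is a nonzero linear combination of simple roots with nonnegative coefficients. Partial order on $T$: $r\succ t$ iff $\alpha_r\succ\alpha_t$. For $x,y\in W$ put $AD(x,y)=\{t\in T: xt>x \text{ and } yt<y\}$. If $\ell(y)>\ell(x)$, a minimal reflection for $(x,y)$ is an element of $AD(x,y)$ that is minimal with respect to $\prec$. *)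

theory Defs
  imports Complex_Main "HOL-Algebra.Multiplicative_Group" "HOL-Algebra.Generated_Groups"
begin

section \<open>Coxeter systems\<close>

definition word_prod :: "('a, 'b) monoid_scheme \<Rightarrow> 'a list \<Rightarrow> 'a" where
  "word_prod G ws = foldr (\<lambda>a b. a \<otimes>\<^bsub>G\<^esub> b) ws \<one>\<^bsub>G\<^esub>"

(* The entry m(s,t) of the Coxeter matrix; group.ord gives 0 for an element of infinite order. *)
definition cox_m :: "('a, 'b) monoid_scheme \<Rightarrow> 'a \<Rightarrow> 'a \<Rightarrow> nat" where
  "cox_m G s t = group.ord G (s \<otimes>\<^bsub>G\<^esub> t)"

(* Deletion of a factor (s t)^m(s,t).  The case s = t has m(s,s) = 1 and gives the relation
   s s = 1; for m(s,t) = 0, i.e. infinite order, the step is trivial. *)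
inductive relator_step :: "('a, 'b) monoid_scheme \<Rightarrow> 'a set \<Rightarrow> 'a list \<Rightarrow> 'a list \<Rightarrow> bool"
  for G S where
  "us \<in> lists S \<Longrightarrow> vs \<in> lists S \<Longrightarrow> s \<in> S \<Longrightarrow> t \<in> S \<Longrightarrow>
    relator_step G S (us @ concat (replicate (cox_m G s t) [s, t]) @ vs) (us @ vs)"

(* W = < S | (s t)^m(s,t) = 1 >, with m(s,s) = 1: the last clause says that two words in S with
   the same value in G are related by the congruence that the relators generate.  Words need no
   formal inverses because s s = 1 is among the relations. *)
definition coxeter_system :: "('a, 'b) monoid_scheme \<Rightarrow> 'a set \<Rightarrow> bool" where
  "coxeter_system G S \<longleftrightarrow>
     group G \<and> S \<subseteq> carrier G \<and> generate G S = carrier G \<and>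
     (\<forall>s\<in>S. group.ord G s = 2) \<and>
     (\<forall>us\<in>lists S. \<forall>vs\<in>lists S.
        word_prod G us = word_prod G vs \<longrightarrow> equivclp (relator_step G S) us vs)"

definition simply_laced :: "('a, 'b) monoid_scheme \<Rightarrow> 'a set \<Rightarrow> bool" where
  "simply_laced G S \<longleftrightarrow> (\<forall>s\<in>S. \<forall>t\<in>S. 1 \<le> cox_m G s t \<and> cox_m G s t \<le> 3)"

definition cox_length :: "('a, 'b) monoid_scheme \<Rightarrow> 'a set \<Rightarrow> 'a \<Rightarrow> nat" where
  "cox_length G S w = (LEAST n. \<exists>ws\<in>lists S. word_prod G ws = w \<and> length ws = n)"

definition reflections :: "('a, 'b) monoid_scheme \<Rightarrow> 'a set \<Rightarrow> 'a set" where
  "reflections G S = {w \<otimes>\<^bsub>G\<^esub> s \<otimes>\<^bsub>G\<^esub> inv\<^bsub>G\<^esub> w | w s. w \<in> carrier G \<and> s \<in> S}"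

section \<open>Bruhat order\<close>

definition bruhat_step :: "('a, 'b) monoid_scheme \<Rightarrow> 'a set \<Rightarrow> 'a \<Rightarrow> 'a \<Rightarrow> bool" where
  "bruhat_step G S u v \<longleftrightarrow> u \<in> carrier G \<and>
     (\<exists>t\<in>reflections G S. v = u \<otimes>\<^bsub>G\<^esub> t) \<and> cox_length G S u < cox_length G S v"

definition bruhat_le :: "('a, 'b) monoid_scheme \<Rightarrow> 'a set \<Rightarrow> 'a \<Rightarrow> 'a \<Rightarrow> bool" where
  "bruhat_le G S u v \<longleftrightarrow> u \<in> carrier G \<and> v \<in> carrier G \<and> (bruhat_step G S)\<^sup>*\<^sup>* u v"

definition bruhat_less :: "('a, 'b) monoid_scheme \<Rightarrow> 'a set \<Rightarrow> 'a \<Rightarrow> 'a \<Rightarrow> bool" where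
  "bruhat_less G S u v \<longleftrightarrow> bruhat_le G S u v \<and> u \<noteq> v"

definition bruhat_interval :: "('a, 'b) monoid_scheme \<Rightarrow> 'a set \<Rightarrow> 'a \<Rightarrow> 'a \<Rightarrow> 'a set" where
  "bruhat_interval G S x y = {z. bruhat_le G S x z \<and> bruhat_le G S z y}"

definition bruhat_cover :: "('a, 'b) monoid_scheme \<Rightarrow> 'a set \<Rightarrow> 'a \<Rightarrow> 'a \<Rightarrow> bool" where
  "bruhat_cover G S x y \<longleftrightarrow>
     bruhat_less G S x y \<and> cox_length G S y = cox_length G S x + 1"

section \<open>Geometric representation and roots\<close>

(* A vector is its coordinate function with respect to the basis of simple roots; it vanishes
   outside S. *)
definition simple_root :: "'a \<Rightarrow> 'a \<Rightarrow> real" where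
  "simple_root s = (\<lambda>u. if u = s then 1 else 0)"

(* The symmetric bilinear form with B(alpha_s, alpha_t) = - cos (pi / m(s,t)), for finite S.  For
   m(s,t) = 0, i.e. infinite order, pi / 0 = 0 gives the usual value -1. *)
definition cox_form ::
    "('a, 'b) monoid_scheme \<Rightarrow> 'a set \<Rightarrow> ('a \<Rightarrow> real) \<Rightarrow> ('a \<Rightarrow> real) \<Rightarrow> real" where
  "cox_form G S v v' = (\<Sum>s\<in>S. \<Sum>t\<in>S. v s * v' t * - cos (pi / real (cox_m G s t)))"

definition simple_reflection ::
    "('a, 'b) monoid_scheme \<Rightarrow> 'a set \<Rightarrow> 'a \<Rightarrow> ('a \<Rightarrow> real) \<Rightarrow> ('a \<Rightarrow> real)" where
  "simple_reflection G S s v =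
     (\<lambda>u. v u - 2 * cox_form G S (simple_root s) v * simple_root s u)"

(* w acts as the composition of the simple reflections of a word for w.  The choice of the word
   is immaterial, since the simple reflections satisfy the defining relations of the group. *)
definition geom_act ::
    "('a, 'b) monoid_scheme \<Rightarrow> 'a set \<Rightarrow> 'a \<Rightarrow> ('a \<Rightarrow> real) \<Rightarrow> ('a \<Rightarrow> real)" where
  "geom_act G S w = foldr (simple_reflection G S) (SOME ws. ws \<in> lists S \<and> word_prod G ws = w)"

definition roots :: "('a, 'b) monoid_scheme \<Rightarrow> 'a set \<Rightarrow> ('a \<Rightarrow> real) set" where
  "roots G S = {geom_act G S w (simple_root s) | w s. w \<in> carrier G \<and> s \<in> S}"

definition pos_roots :: "('a, 'b) monoid_scheme \<Rightarrow> 'a set \<Rightarrow> ('a \<Rightarrow> real) set" where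
  "pos_roots G S = {\<alpha> \<in> roots G S. \<forall>s\<in>S. 0 \<le> \<alpha> s}"

definition refl_root :: "('a, 'b) monoid_scheme \<Rightarrow> 'a set \<Rightarrow> 'a \<Rightarrow> ('a \<Rightarrow> real)" where
  "refl_root G S t = (THE \<alpha>. \<alpha> \<in> pos_roots G S \<and>
     (\<exists>w\<in>carrier G. \<exists>s\<in>S. t = w \<otimes>\<^bsub>G\<^esub> s \<otimes>\<^bsub>G\<^esub> inv\<^bsub>G\<^esub> w \<and>
        bruhat_less G S w (w \<otimes>\<^bsub>G\<^esub> s) \<and> \<alpha> = geom_act G S w (simple_root s)))"

definition root_less :: "'a set \<Rightarrow> ('a \<Rightarrow> real) \<Rightarrow> ('a \<Rightarrow> real) \<Rightarrow> bool" where
  "root_less S \<beta> \<alpha> \<longleftrightarrow> \<alpha> \<noteq> \<beta> \<and> (\<exists>c. (\<forall>s\<in>S. 0 \<le> c s) \<and>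
     (\<forall>u. \<alpha> u - \<beta> u = (\<Sum>s\<in>S. c s * simple_root s u)))"

definition refl_less :: "('a, 'b) monoid_scheme \<Rightarrow> 'a set \<Rightarrow> 'a \<Rightarrow> 'a \<Rightarrow> bool" where
  "refl_less G S t r \<longleftrightarrow> root_less S (refl_root G S t) (refl_root G S r)"

section \<open>Minimal reflections\<close>

definition AD :: "('a, 'b) monoid_scheme \<Rightarrow> 'a set \<Rightarrow> 'a \<Rightarrow> 'a \<Rightarrow> 'a set" where
  "AD G S x y = {t \<in> reflections G S.
     bruhat_less G S x (x \<otimes>\<^bsub>G\<^esub> t) \<and> bruhat_less G S (y \<otimes>\<^bsub>G\<^esub> t) y}"

definition minimal_reflection ::
    "('a, 'b) monoid_scheme \<Rightarrow> 'a set \<Rightarrow> 'a \<Rightarrow> 'a \<Rightarrow> 'a \<Rightarrow> bool" where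
  "minimal_reflection G S x y t \<longleftrightarrow> cox_length G S x < cox_length G S y \<and>
     t \<in> AD G S x y \<and> \<not> (\<exists>r\<in>AD G S x y. refl_less G S r t)"

end

theory Submission
  imports Defs "HOL-Library.Function_Algebras"
begin

text \<open>Write N(w) for the set of positive roots that w makes negative. For a positive root a with
reflection t one has x t > x iff a is not in N(x), and y t < y iff a is in N(y), so AD(x, y)
corresponds to N(y) - N(x). Let a be the root of a minimal reflection t: every positive root
below a that lies in N(y) also lies in N(x). The relation to a decomposition a = b + c into
positive roots is then rigid: x and y give b the same sign, and exactly one of b, c is made
negative (\<open>summands_agree\<close>). The theorem rests on three consequences.

First, x \<le> y t (\<open>generalized_lifting\<close>). For simple a this is the lifting property. Otherwise
a = b + \<alpha>(s) with s simple, and s a = b; by rigidity s is an ascent of both x and y or a descent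
of both, so (x s, y s) is again comparable, b is minimal for it, and the result for b translates
back along s.

Secondly, if z makes a positive and makes exactly one summand negative in each decomposition
a = b + c, then z t covers z (\<open>splits_cover\<close>), by the same descent from a to b. All elements z
with the following prescribed signs are of this kind: z is negative on the roots below a that lie
in N(y), and positive on a and on those summands of a that do not lie in N(y). They form the
minimal cell; x and y t belong to it.

Thirdly, for suitable F and B, two comparable elements of the cell consisting of the z with
F \<subseteq> N(z) and B disjoint from N(z) are joined by a saturated Bruhat chain inside the cell
(\<open>cell_chain\<close>). The condition is that F \<union> B is coclosed: a sum of two positive roots lies in it
only if one of the summands does. For empty F this is proved by induction along left descents and
contains, for the groups considered here, the theorem of Bjorner and Wachs that generalized
quotients of Coxeter groups are graded.
The general case is reduced to it by right translations by simple reflections.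

A chain in the minimal cell from x to y t is the required one. The remaining relation z t \<le> y
holds for z = y t and descends along the chain, because z t and z' t differ by a reflection and
have consecutive lengths whenever z' covers z in the cell.\<close>

section \<open>Words and lengths\<close>

locale simply_laced_coxeter =
  fixes G :: "('a, 'b) monoid_scheme" (structure) and S :: "'a set"
  assumes coxeter: "coxeter_system G S"
    and finite_carrier: "finite (carrier G)"
    and laced: "simply_laced G S"
begin

sublocale group G
  using coxeter by (simp add: coxeter_system_def)

abbreviation len :: "'a \<Rightarrow> nat" where "len \<equiv> cox_length G S"

lemma gen_closed: "s \<in> S \<Longrightarrow> s \<in> carrier G"
  using coxeter by (auto simp: coxeter_system_def)

lemma finite_gens: "finite S"
  using coxeter finite_carrier finite_subset by (auto simp: coxeter_system_def)

lemma gen_square: "s \<in> S \<Longrightarrow> s \<otimes> s = \<one>"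
proof -
  assume s: "s \<in> S"
  have "ord s = 2" using s coxeter by (auto simp: coxeter_system_def)
  then have "s [^] (2::nat) = \<one>" using pow_ord_eq_1[OF gen_closed[OF s]] by simp
  then show ?thesis using gen_closed[OF s] by (simp add: numeral_2_eq_2)
qed

lemma gen_inv: "s \<in> S \<Longrightarrow> inv s = s"
  by (simp add: gen_square gen_closed inv_equality)

lemma gen_cancel: "w \<in> carrier G \<Longrightarrow> s \<in> S \<Longrightarrow> w \<otimes> s \<otimes> s = w"
  by (simp add: m_assoc gen_closed gen_square)

lemma gen_cancel_left: "w \<in> carrier G \<Longrightarrow> s \<in> S \<Longrightarrow> s \<otimes> (s \<otimes> w) = w"
  by (simp add: m_assoc[symmetric] gen_closed gen_square)

lemma word_prod_Nil [simp]: "word_prod G [] = \<one>"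
  by (simp add: word_prod_def)

lemma word_prod_Cons [simp]: "word_prod G (a # ws) = a \<otimes> word_prod G ws"
  by (simp add: word_prod_def)

lemma word_prod_closed: "ws \<in> lists S \<Longrightarrow> word_prod G ws \<in> carrier G"
  by (induction ws) (auto simp: gen_closed)

lemma word_prod_append:
  "us \<in> lists S \<Longrightarrow> vs \<in> lists S \<Longrightarrow> word_prod G (us @ vs) = word_prod G us \<otimes> word_prod G vs"
  by (induction us) (auto simp: gen_closed word_prod_closed m_assoc)

lemma word_exists:
  assumes "w \<in> carrier G"
  obtains ws where "ws \<in> lists S" "word_prod G ws = w"
proof -
  have "w \<in> generate G S" using assms coxeter by (simp add: coxeter_system_def)
  then have "\<exists>ws\<in>lists S. word_prod G ws = w"
  proof induction
    case one
    have "[] \<in> lists S" "word_prod G [] = \<one>" by simp_all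
    then show ?case by blast
  next
    case (incl h)
    then have "[h] \<in> lists S" "word_prod G [h] = h" by (simp_all add: gen_closed)
    then show ?case by blast
  next
    case (inv h)
    then have "[h] \<in> lists S" "word_prod G [h] = inv h" by (simp_all add: gen_inv gen_closed)
    then show ?case by blast
  next
    case (eng h1 h2)
    then obtain us vs where "us \<in> lists S" "word_prod G us = h1" "vs \<in> lists S" "word_prod G vs = h2"
      by blast
    then have "us @ vs \<in> lists S" "word_prod G (us @ vs) = h1 \<otimes> h2"
      by (simp_all add: word_prod_append)
    then show ?case by blast
  qed
  then show ?thesis using that by blast
qed

lemma len_le: "ws \<in> lists S \<Longrightarrow> word_prod G ws = w \<Longrightarrow> len w \<le> length ws"
  unfolding cox_length_def by (rule Least_le) blast

lemma reduced_word:
  assumes "w \<in> carrier G"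
  obtains ws where "ws \<in> lists S" "word_prod G ws = w" "length ws = len w"
proof -
  have "\<exists>n. \<exists>ws\<in>lists S. word_prod G ws = w \<and> length ws = n"
    using word_exists[OF assms] by blast
  from LeastI_ex[OF this] show ?thesis using that unfolding cox_length_def by blast
qed

lemma len_one [simp]: "len \<one> = 0"
  using len_le[of "[]" \<one>] by simp

lemma len_mult_le:
  assumes "v \<in> carrier G" "w \<in> carrier G"
  shows "len (v \<otimes> w) \<le> len v + len w"
proof -
  obtain us vs where "us \<in> lists S" "word_prod G us = v" "length us = len v"
     "vs \<in> lists S" "word_prod G vs = w" "length vs = len w"
    using assms reduced_word by metis
  then show ?thesis using len_le[of "us @ vs"] by (simp add: word_prod_append)
qed

lemma len_gen_le: "s \<in> S \<Longrightarrow> len s \<le> 1"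
  using len_le[of "[s]"] by (simp add: gen_closed)

lemma len_inv:
  assumes "w \<in> carrier G"
  shows "len (inv w) = len w"
proof -
  have rev: "word_prod G (rev ws) = inv (word_prod G ws)" if "ws \<in> lists S" for ws
    using that
    by (induction ws) (auto simp: word_prod_append word_prod_closed gen_closed inv_mult_group gen_inv in_lists_conv_set)
  have le: "len (inv v) \<le> len v" if v: "v \<in> carrier G" for v
  proof -
    obtain ws where ws: "ws \<in> lists S" "word_prod G ws = v" "length ws = len v"
      using reduced_word[OF v] .
    then have "len (inv v) \<le> length (rev ws)" by (intro len_le) (auto simp: rev in_lists_conv_set)
    then show ?thesis using ws by simp
  qed
  show ?thesis using le[OF assms] le[of "inv w"] assms by simp
qed

text \<open>Every relator has even length, so the parity of the length of a word depends on its value only.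
In particular multiplication by a generator always changes the length.\<close>

lemma len_parity:
  assumes "ws \<in> lists S" "word_prod G ws = w"
  shows "even (length ws) = even (len w)"
proof -
  have "w \<in> carrier G" using assms word_prod_closed by blast
  then obtain vs where vs: "vs \<in> lists S" "word_prod G vs = w" "length vs = len w"
    by (rule reduced_word)
  have "equivclp (relator_step G S) ws vs"
    using assms vs coxeter by (auto simp: coxeter_system_def)
  then have "even (length ws) = even (length vs)"
  proof (induction rule: equivclp_induct)
    case (step y z)
    have len2: "even (length (concat (replicate n [s, t])))" for n and s t :: 'a
      by (induction n) auto
    from step(2) have "even (length y) = even (length z)"
      by (auto elim!: relator_step.cases simp: len2)
    with step show ?case by simp
  qed simp
  then show ?thesis using vs by simp
qed

lemma len_right:
  assumes w: "w \<in> carrier G" and s: "s \<in> S"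
  shows "len (w \<otimes> s) = Suc (len w) \<or> len w = Suc (len (w \<otimes> s))"
proof -
  obtain ws where ws: "ws \<in> lists S" "word_prod G ws = w" "length ws = len w"
    using reduced_word[OF w] .
  have "even (length (ws @ [s])) = even (len (w \<otimes> s))"
    by (rule len_parity) (use ws s in \<open>simp_all add: word_prod_append gen_closed\<close>)
  then have "even (Suc (len w)) = even (len (w \<otimes> s))" using ws by simp
  then have "len (w \<otimes> s) \<noteq> len w" by auto
  moreover have "len (w \<otimes> s) \<le> Suc (len w)"
    using len_mult_le[OF w gen_closed[OF s]] len_gen_le[OF s] by simp
  moreover have "len w \<le> Suc (len (w \<otimes> s))"
    using len_mult_le[of "w \<otimes> s" s] len_gen_le[OF s] w s by (simp add: gen_closed gen_cancel)
  ultimately show ?thesis by linarith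
qed

lemma len_left:
  assumes w: "w \<in> carrier G" and s: "s \<in> S"
  shows "len (s \<otimes> w) = Suc (len w) \<or> len w = Suc (len (s \<otimes> w))"
proof -
  have "len (inv w \<otimes> s) = len (s \<otimes> w)"
    using len_inv[of "s \<otimes> w"] w s by (simp add: inv_mult_group gen_closed gen_inv)
  then show ?thesis using len_right[of "inv w" s] w s by (simp add: len_inv)
qed

lemma right_descent_exists:
  assumes w: "w \<in> carrier G" "w \<noteq> \<one>"
  obtains s where "s \<in> S" "len (w \<otimes> s) < len w"
proof -
  obtain ws where ws: "ws \<in> lists S" "word_prod G ws = w" "length ws = len w"
    using reduced_word[OF w(1)] .
  then have "ws \<noteq> []" using w by auto
  then obtain us s where us: "ws = us @ [s]" by (metis rev_exhaust)
  then have s: "s \<in> S" "us \<in> lists S" using ws by auto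
  have "w \<otimes> s = word_prod G us"
    using ws us s word_prod_closed[OF s(2)] by (auto simp: word_prod_append gen_closed gen_cancel)
  then have "len (w \<otimes> s) \<le> length us" using len_le[of us "w \<otimes> s"] s by simp
  then show ?thesis using that[of s] s us ws by simp
qed

lemma left_descent_exists:
  assumes w: "w \<in> carrier G" "w \<noteq> \<one>"
  obtains s where "s \<in> S" "len (s \<otimes> w) < len w"
proof -
  have "inv w \<in> carrier G" "inv w \<noteq> \<one>" using w by (auto simp: inv_eq_1_iff)
  then obtain s where s: "s \<in> S" "len (inv w \<otimes> s) < len (inv w)" by (rule right_descent_exists)
  have "len (inv w \<otimes> s) = len (s \<otimes> w)"
    using len_inv[of "s \<otimes> w"] w s by (simp add: inv_mult_group gen_closed gen_inv)
  then show ?thesis using that[of s] s w by (simp add: len_inv)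
qed

lemma cox_m_same: "s \<in> S \<Longrightarrow> cox_m G s s = 1"
  by (simp add: cox_m_def gen_square)

lemma cox_m_cases: "s \<in> S \<Longrightarrow> t \<in> S \<Longrightarrow> s \<noteq> t \<Longrightarrow> cox_m G s t = 2 \<or> cox_m G s t = 3"
proof -
  assume st: "s \<in> S" "t \<in> S" "s \<noteq> t"
  have "cox_m G s t \<noteq> 1"
  proof
    assume "cox_m G s t = 1"
    then have "s \<otimes> t = \<one>"
      using st gen_closed m_closed ord_eq_1 unfolding cox_m_def by metis
    then have "inv t = s" using st by (simp add: inv_equality gen_closed)
    then show False using st by (simp add: gen_inv)
  qed
  moreover have "1 \<le> cox_m G s t" "cox_m G s t \<le> 3"
    using laced st by (auto simp: simply_laced_def)
  ultimately show ?thesis by linarith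
qed

lemma cox_m_sym: "s \<in> S \<Longrightarrow> t \<in> S \<Longrightarrow> cox_m G s t = cox_m G t s"
  using ord_inv[of "s \<otimes> t"] by (simp add: cox_m_def inv_mult_group gen_closed gen_inv)

lemma commute_gens:
  assumes "s \<in> S" "t \<in> S" "cox_m G s t = 2"
  shows "s \<otimes> t = t \<otimes> s"
proof -
  have "(s \<otimes> t) [^] (2::nat) = \<one>"
    using assms gen_closed m_closed pow_ord_eq_1 unfolding cox_m_def by metis
  then have "(s \<otimes> t) \<otimes> (s \<otimes> t) = \<one>" using assms by (simp add: numeral_2_eq_2 gen_closed)
  then have "inv (s \<otimes> t) = s \<otimes> t" using assms by (simp add: inv_equality gen_closed)
  then show ?thesis using assms by (simp add: inv_mult_group gen_closed gen_inv)
qed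

lemma braid_gens:
  assumes "s \<in> S" "t \<in> S" "cox_m G s t = 3"
  shows "s \<otimes> t \<otimes> s = t \<otimes> s \<otimes> t"
proof -
  have "(s \<otimes> t) [^] (3::nat) = \<one>"
    using assms gen_closed m_closed pow_ord_eq_1 unfolding cox_m_def by metis
  then have "(s \<otimes> t \<otimes> s) \<otimes> (t \<otimes> s \<otimes> t) = \<one>"
    using assms by (simp add: numeral_3_eq_3 gen_closed m_assoc)
  then have "inv (t \<otimes> s \<otimes> t) = s \<otimes> t \<otimes> s" using assms by (simp add: inv_equality gen_closed)
  then show ?thesis using assms by (simp add: inv_mult_group gen_closed gen_inv m_assoc)
qed

end

section \<open>The geometric representation\<close>

definition scale :: "real \<Rightarrow> ('a \<Rightarrow> real) \<Rightarrow> 'a \<Rightarrow> real" (infixr "\<cdot>" 75) where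
  "c \<cdot> v = (\<lambda>u. c * v u)"

lemma scale_apply [simp]: "(c \<cdot> v) u = c * v u"
  by (simp add: scale_def)

context simply_laced_coxeter
begin

abbreviation act :: "'a \<Rightarrow> ('a \<Rightarrow> real) \<Rightarrow> 'a \<Rightarrow> real" where "act \<equiv> geom_act G S"
abbreviation R :: "('a \<Rightarrow> real) set" where "R \<equiv> roots G S"
abbreviation P :: "('a \<Rightarrow> real) set" where "P \<equiv> pos_roots G S"

text \<open>Twice the form of the geometric representation: roots then have norm 2, and in the simply-laced
case the form is integral on roots.\<close>

definition ip :: "('a \<Rightarrow> real) \<Rightarrow> ('a \<Rightarrow> real) \<Rightarrow> real" where
  "ip v w = 2 * cox_form G S v w"

definition cartan :: "'a \<Rightarrow> 'a \<Rightarrow> real" where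
  "cartan s t = - 2 * cos (pi / real (cox_m G s t))"

lemma ip_expand: "ip v w = (\<Sum>s\<in>S. \<Sum>t\<in>S. v s * w t * cartan s t)"
  unfolding ip_def cox_form_def cartan_def sum_distrib_left
  by (intro sum.cong refl) simp

lemma cartan_same: "s \<in> S \<Longrightarrow> cartan s s = 2"
  by (simp add: cartan_def cox_m_same)

lemma cartan_commuting: "cox_m G s t = 2 \<Longrightarrow> cartan s t = 0"
  by (simp add: cartan_def)

lemma cartan_braiding: "cox_m G s t = 3 \<Longrightarrow> cartan s t = -1"
  by (simp add: cartan_def cos_60)

lemma cartan_cases: "s \<in> S \<Longrightarrow> t \<in> S \<Longrightarrow> cartan s t = 2 \<or> cartan s t = 0 \<or> cartan s t = -1"
  using cox_m_cases cartan_same cartan_commuting cartan_braiding by metis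

lemma ip_sym: "ip v w = ip w v"
proof -
  have "ip v w = (\<Sum>t\<in>S. \<Sum>s\<in>S. v s * w t * cartan s t)"
    unfolding ip_expand by (rule sum.swap)
  also have "\<dots> = ip w v"
    unfolding ip_expand cartan_def by (intro sum.cong refl) (simp add: cox_m_sym)
  finally show ?thesis .
qed

lemma ip_add_left: "ip (u + v) w = ip u w + ip v w"
  unfolding ip_expand by (simp add: algebra_simps sum.distrib)

lemma ip_diff_left: "ip (u - v) w = ip u w - ip v w"
  unfolding ip_expand by (simp add: algebra_simps sum_subtractf)

lemma ip_scale_left: "ip (c \<cdot> v) w = c * ip v w"
  unfolding ip_expand sum_distrib_left by (simp add: algebra_simps)

lemma ip_minus_left: "ip (- v) w = - ip v w"
  unfolding ip_expand by (simp add: sum_negf)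

lemma ip_add_right: "ip w (u + v) = ip w u + ip w v"
  using ip_add_left ip_sym by metis

lemma ip_diff_right: "ip w (u - v) = ip w u - ip w v"
  using ip_diff_left ip_sym by metis

lemma ip_scale_right: "ip w (c \<cdot> v) = c * ip w v"
  using ip_scale_left ip_sym by metis

lemma ip_minus_right: "ip w (- v) = - ip w v"
  using ip_minus_left ip_sym by metis

lemmas ip_linear = ip_add_left ip_diff_left ip_scale_left ip_minus_left
  ip_add_right ip_diff_right ip_scale_right ip_minus_right

lemma ip_simple_left: "s \<in> S \<Longrightarrow> ip (simple_root s) v = (\<Sum>t\<in>S. v t * cartan s t)"
proof -
  assume s: "s \<in> S"
  have "ip (simple_root s) v = (\<Sum>r\<in>S. if r = s then (\<Sum>t\<in>S. v t * cartan s t) else 0)"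
    unfolding ip_expand by (intro sum.cong refl) (auto simp: simple_root_def)
  then show ?thesis using s finite_gens by simp
qed

lemma ip_simple: "s \<in> S \<Longrightarrow> t \<in> S \<Longrightarrow> ip (simple_root s) (simple_root t) = cartan s t"
proof -
  assume st: "s \<in> S" "t \<in> S"
  have "ip (simple_root s) (simple_root t) = (\<Sum>r\<in>S. if r = t then cartan s t else 0)"
    unfolding ip_simple_left[OF st(1)] by (intro sum.cong refl) (auto simp: simple_root_def)
  then show ?thesis using st finite_gens by simp
qed

lemma ip_as_sum: "ip v w = (\<Sum>s\<in>S. v s * ip (simple_root s) w)"
  unfolding ip_expand[of v w]
  by (intro sum.cong refl) (simp add: ip_simple_left sum_distrib_left mult.assoc)

definition reflect :: "('a \<Rightarrow> real) \<Rightarrow> ('a \<Rightarrow> real) \<Rightarrow> 'a \<Rightarrow> real" where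
  "reflect a v = v - ip a v \<cdot> a"

lemma simple_reflection_eq: "simple_reflection G S s v = reflect (simple_root s) v"
  by (rule ext) (simp add: simple_reflection_def reflect_def ip_def)

lemma reflect_add: "reflect a (v + w) = reflect a v + reflect a w"
  by (rule ext) (simp add: reflect_def ip_linear algebra_simps)

lemma reflect_scale: "reflect a (c \<cdot> v) = c \<cdot> reflect a v"
  by (rule ext) (simp add: reflect_def ip_linear algebra_simps)

lemma reflect_ip: "ip a a = 2 \<Longrightarrow> ip (reflect a v) (reflect a w) = ip v w"
  by (simp add: reflect_def ip_linear ip_sym[of v a])

lemma reflect_involution: "ip a a = 2 \<Longrightarrow> reflect a (reflect a v) = v"
  by (rule ext) (simp add: reflect_def ip_linear)

abbreviation word_act :: "'a list \<Rightarrow> ('a \<Rightarrow> real) \<Rightarrow> 'a \<Rightarrow> real" where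
  "word_act \<equiv> foldr (simple_reflection G S)"

text \<open>A direct computation for each of the possible orders 1, 2, 3 of a product of two generators; it
makes the action of a group element independent of the word that represents it.\<close>

lemma word_act_relator:
  assumes s: "s \<in> S" and t: "t \<in> S"
  shows "word_act (concat (replicate (cox_m G s t) [s, t])) v = v"
proof -
  let ?a = "simple_root s" and ?b = "simple_root t"
  note simps = reflect_def ip_linear ip_simple cartan_same s t
  consider "s = t" | "s \<noteq> t" "cox_m G s t = 2" | "s \<noteq> t" "cox_m G s t = 3"
    using cox_m_cases[OF s t] by blast
  then show ?thesis
  proof cases
    case 1
    then show ?thesis using s
      by (simp add: cox_m_same simple_reflection_eq reflect_involution ip_simple cartan_same)
  next
    case 2
    then have "cartan s t = 0" "cartan t s = 0"
      using cox_m_sym[OF s t] by (simp_all add: cartan_commuting)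
    then show ?thesis
      by (intro ext)
        (simp add: 2 simple_reflection_eq numeral_2_eq_2 simps algebra_simps)
  next
    case 3
    then have "cartan s t = -1" "cartan t s = -1"
      using cox_m_sym[OF s t] by (simp_all add: cartan_braiding)
    then show ?thesis
      by (intro ext)
        (simp add: 3 simple_reflection_eq numeral_3_eq_3 simps algebra_simps)
  qed
qed

lemma word_act_cong:
  assumes "us \<in> lists S" "vs \<in> lists S" "word_prod G us = word_prod G vs"
  shows "word_act us v = word_act vs v"
proof -
  have "equivclp (relator_step G S) us vs"
    using assms coxeter by (auto simp: coxeter_system_def)
  then show ?thesis
  proof (induction rule: equivclp_induct)
    case (step y z)
    from step(2) have "word_act y v = word_act z v"
      by (auto elim!: relator_step.cases simp: word_act_relator)
    with step show ?case by simp
  qed simp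
qed

lemma act_word:
  assumes "ws \<in> lists S"
  shows "act (word_prod G ws) v = word_act ws v"
proof -
  let ?vs = "SOME vs. vs \<in> lists S \<and> word_prod G vs = word_prod G ws"
  have "?vs \<in> lists S \<and> word_prod G ?vs = word_prod G ws"
    by (rule someI[of _ ws]) (use assms in simp)
  then show ?thesis unfolding geom_act_def using assms word_act_cong by blast
qed

lemma act_mult:
  assumes "u \<in> carrier G" "w \<in> carrier G"
  shows "act (u \<otimes> w) v = act u (act w v)"
proof -
  obtain us ws where "us \<in> lists S" "word_prod G us = u" "ws \<in> lists S" "word_prod G ws = w"
    using assms word_exists by metis
  then show ?thesis
    using act_word[of us] act_word[of ws] act_word[of "us @ ws"] by (auto simp: word_prod_append)
qed

lemma act_one [simp]: "act \<one> v = v"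
  using act_word[of "[]"] by simp

lemma act_gen: "s \<in> S \<Longrightarrow> act s v = reflect (simple_root s) v"
  using act_word[of "[s]"] by (simp add: gen_closed simple_reflection_eq)

lemma act_inv_cancel [simp]: "w \<in> carrier G \<Longrightarrow> act (inv w) (act w v) = v"
  using act_mult[of "inv w" w] by simp

lemma act_cancel_inv [simp]: "w \<in> carrier G \<Longrightarrow> act w (act (inv w) v) = v"
  using act_mult[of w "inv w"] by simp

lemma act_induct:
  assumes "w \<in> carrier G" "Q \<one>" "\<And>s w. s \<in> S \<Longrightarrow> w \<in> carrier G \<Longrightarrow> Q w \<Longrightarrow> Q (s \<otimes> w)"
  shows "Q w"
proof -
  obtain ws where ws: "ws \<in> lists S" "word_prod G ws = w" using word_exists[OF assms(1)] .
  have "Q (word_prod G ws)" using ws(1)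
    by (induction ws) (auto intro: assms(2,3) word_prod_closed)
  then show ?thesis using ws by simp
qed

lemma simple_norm: "s \<in> S \<Longrightarrow> ip (simple_root s) (simple_root s) = 2"
  by (simp add: ip_simple cartan_same)

lemma act_add: "w \<in> carrier G \<Longrightarrow> act w (u + v) = act w u + act w v"
  by (erule act_induct[where Q = "\<lambda>w. act w (u + v) = act w u + act w v"])
    (simp_all add: act_mult gen_closed act_gen reflect_add del: plus_fun_apply)

lemma act_scale: "w \<in> carrier G \<Longrightarrow> act w (c \<cdot> v) = c \<cdot> act w v"
  by (erule act_induct[where Q = "\<lambda>w. act w (c \<cdot> v) = c \<cdot> act w v"])
    (simp_all add: act_mult gen_closed act_gen reflect_scale)

lemma act_minus: "w \<in> carrier G \<Longrightarrow> act w (- v) = - act w v"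
proof -
  have m: "- u = (-1) \<cdot> u" for u :: "'a \<Rightarrow> real" by (rule ext) simp
  show "w \<in> carrier G \<Longrightarrow> act w (- v) = - act w v" unfolding m by (rule act_scale)
qed

lemma act_diff: "w \<in> carrier G \<Longrightarrow> act w (u - v) = act w u - act w v"
  using act_add[of w u "- v"] act_minus[of w v] by simp

lemma act_ip: "w \<in> carrier G \<Longrightarrow> ip (act w u) (act w v) = ip u v"
  by (erule act_induct) (simp_all add: act_mult gen_closed act_gen reflect_ip simple_norm)

lemma act_reflect: "w \<in> carrier G \<Longrightarrow> act w (reflect a v) = reflect (act w a) (act w v)"
  by (simp add: reflect_def act_diff act_scale act_ip)

lemma act_gen_self: "s \<in> S \<Longrightarrow> act s (simple_root s) = - simple_root s"
  by (rule ext) (simp add: act_gen reflect_def simple_norm)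

section \<open>Roots\<close>

lemma act_root: "w \<in> carrier G \<Longrightarrow> a \<in> R \<Longrightarrow> act w a \<in> R"
  unfolding roots_def using act_mult m_closed by (smt (verit) mem_Collect_eq)

lemma simple_in_R: "s \<in> S \<Longrightarrow> simple_root s \<in> R"
  unfolding roots_def using act_one one_closed by (metis (mono_tags, lifting) mem_Collect_eq)

lemma rootE:
  assumes "a \<in> R"
  obtains w s where "w \<in> carrier G" "s \<in> S" "a = act w (simple_root s)"
  using assms unfolding roots_def by blast

lemma root_norm: "a \<in> R \<Longrightarrow> ip a a = 2"
  by (erule rootE) (simp add: act_ip simple_norm)

lemma neg_root: "a \<in> R \<Longrightarrow> - a \<in> R"
proof (erule rootE)
  fix w s assume *: "w \<in> carrier G" "s \<in> S" "a = act w (simple_root s)"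
  then have "- a = act w (act s (simple_root s))" by (simp add: act_gen_self act_minus)
  then show ?thesis using * by (simp add: act_root simple_in_R gen_closed)
qed

lemma finite_R: "finite R"
proof -
  have "R = (\<lambda>(w, s). act w (simple_root s)) ` (carrier G \<times> S)"
    unfolding roots_def by auto
  then show ?thesis using finite_carrier finite_gens by simp
qed

lemma root_coord:
  assumes "a \<in> R"
  shows "a u \<in> \<int>" "u \<notin> S \<Longrightarrow> a u = 0"
proof -
  obtain w s where w: "w \<in> carrier G" "s \<in> S" "a = act w (simple_root s)"
    using assms by (rule rootE)
  have "(\<forall>u. act w (simple_root s) u \<in> \<int>) \<and> (\<forall>u. u \<notin> S \<longrightarrow> act w (simple_root s) u = 0)"
    using w(1)
  proof (rule act_induct)
    show "(\<forall>u. act \<one> (simple_root s) u \<in> \<int>) \<and> (\<forall>u. u \<notin> S \<longrightarrow> act \<one> (simple_root s) u = 0)"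
      using w(2) by (auto simp: simple_root_def)
  next
    fix r w' assume r: "r \<in> S" "w' \<in> carrier G"
      and IH: "(\<forall>u. act w' (simple_root s) u \<in> \<int>) \<and> (\<forall>u. u \<notin> S \<longrightarrow> act w' (simple_root s) u = 0)"
    have "cartan r t \<in> \<int>" if "t \<in> S" for t
      using cartan_cases[OF r(1) that] by auto
    then have "ip (simple_root r) (act w' (simple_root s)) \<in> \<int>"
      unfolding ip_simple_left[OF r(1)] using IH by (intro Ints_sum Ints_mult) auto
    then show "(\<forall>u. act (r \<otimes> w') (simple_root s) u \<in> \<int>) \<and>
        (\<forall>u. u \<notin> S \<longrightarrow> act (r \<otimes> w') (simple_root s) u = 0)"
      using IH r by (auto simp: act_mult gen_closed act_gen reflect_def simple_root_def)
  qed
  then show "a u \<in> \<int>" "u \<notin> S \<Longrightarrow> a u = 0" using w(3) by auto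
qed

lemma ip_root_int:
  assumes "a \<in> R" "b \<in> R"
  shows "ip a b \<in> \<int>"
proof -
  have "cartan s t \<in> \<int>" if "s \<in> S" "t \<in> S" for s t
    using cartan_cases[OF that] by auto
  then show ?thesis
    unfolding ip_expand using root_coord(1)[OF assms(1)] root_coord(1)[OF assms(2)]
    by (auto intro!: Ints_sum Ints_mult)
qed

section \<open>Positive roots and reflections\<close>

lemma act_right: "w \<in> carrier G \<Longrightarrow> s \<in> S \<Longrightarrow> act (w \<otimes> s) v = act w (reflect (simple_root s) v)"
  by (simp add: act_mult gen_closed act_gen)

text \<open>This is where lengths and signs of roots meet. The general argument splits off from w its factor
in the dihedral group of s and a descent t. Here that factor has at most two letters, and
\<open>act w (simple_root s)\<close> turns into the image of one of the roots \<alpha>(s), \<alpha>(s) + \<alpha>(t), \<alpha>(t) under a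
shorter element.\<close>

lemma ascent_nonneg:
  assumes "w \<in> carrier G" "s \<in> S" "len w < len (w \<otimes> s)"
  shows "0 \<le> act w (simple_root s) u"
  using assms
proof (induction "len w" arbitrary: w s rule: less_induct)
  case less
  note w = less.prems(1) and s = less.prems(2) and up = less.prems(3)
  show ?case
  proof (cases "w = \<one>")
    case True
    then show ?thesis by (simp add: simple_root_def)
  next
    case False
    obtain t where t: "t \<in> S" "len (w \<otimes> t) < len w"
      using right_descent_exists[OF w False] .
    have st: "s \<noteq> t" using t up by auto
    define v where "v = w \<otimes> t"
    have v: "v \<in> carrier G" "len v < len w" "v \<otimes> t = w"
      using t w by (auto simp: v_def gen_closed gen_cancel)
    have act_w: "act w x = act v (reflect (simple_root t) x)" for x
      using act_right[OF v(1) t(1)] v(3) by simp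
    \<comment> \<open>For commuting s and t the roots w \<alpha>(s) and v \<alpha>(s) agree; otherwise w \<alpha>(s) = v \<alpha>(s) + v \<alpha>(t), where s may be another descent of v.\<close>
    consider (comm) "cox_m G t s = 2" | (braid) "cox_m G t s = 3"
      using cox_m_cases[OF t(1) s] st by blast
    then show ?thesis
    proof cases
      case comm
      have "reflect (simple_root t) (simple_root s) = simple_root s"
        by (rule ext) (simp add: reflect_def ip_simple t s cartan_commuting comm)
      moreover have "len v < len (v \<otimes> s)"
      proof (rule ccontr)
        assume "\<not> len v < len (v \<otimes> s)"
        then have "len (v \<otimes> s) < len v" using len_right[OF v(1) s] by auto
        moreover have "w \<otimes> s = v \<otimes> s \<otimes> t"
          unfolding v(3)[symmetric] using v(1) commute_gens[OF t(1) s comm] t s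
          by (simp add: m_assoc gen_closed)
        ultimately show False
          using len_right[of "v \<otimes> s" t] v t s up by (auto simp: gen_closed)
      qed
      ultimately show ?thesis using less.hyps[OF v(2) v(1) s] act_w by simp
    next
      case braid
      have sum: "reflect (simple_root t) (simple_root s) = simple_root s + simple_root t"
        by (rule ext) (simp add: reflect_def ip_simple t s cartan_braiding braid)
      have vt: "0 \<le> act v (simple_root t) u"
        using less.hyps[OF v(2) v(1) t(1)] v by simp
      show ?thesis
      proof (cases "len v < len (v \<otimes> s)")
        case True
        then show ?thesis
          using less.hyps[OF v(2) v(1) s] vt act_w by (simp add: sum act_add v)
      next
        case False
        define x where "x = v \<otimes> s"
        have x: "x \<in> carrier G" "Suc (len x) = len v" "x \<otimes> s = v"
          using False len_right[OF v(1) s] v s by (auto simp: x_def gen_closed gen_cancel)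
        have "reflect (simple_root s) (simple_root s + simple_root t) = simple_root t"
          using cox_m_sym[OF s t(1)]
          by (intro ext) (simp add: reflect_def ip_linear ip_simple t s cartan_same cartan_braiding braid)
        then have eq: "act w (simple_root s) = act x (simple_root t)"
          using act_w act_right[OF x(1) s] x(3) sum by simp
        have "len x < len (x \<otimes> t)"
        proof (rule ccontr)
          assume "\<not> len x < len (x \<otimes> t)"
          then have lt: "len (x \<otimes> t) < len x" using len_right[OF x(1) t(1)] by auto
          have "w \<otimes> s = x \<otimes> t \<otimes> s \<otimes> t"
            unfolding v(3)[symmetric] x(3)[symmetric]
            using x(1) braid_gens[OF t(1) s braid] t s by (simp add: m_assoc gen_closed)
          then have "len (w \<otimes> s) \<le> Suc (Suc (len (x \<otimes> t)))"
            using len_right[of "x \<otimes> t \<otimes> s" t] len_right[of "x \<otimes> t" s] x t s by (auto simp: gen_closed)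
          then show False using lt x up v by linarith
        qed
        then show ?thesis using less.hyps[of x t] x v t eq by simp
      qed
    qed
  qed
qed

lemma root_ne_zero: "a \<in> R \<Longrightarrow> a \<noteq> 0"
  using root_norm[of a] by (auto simp: ip_expand)

lemma P_iff: "a \<in> P \<longleftrightarrow> a \<in> R \<and> (\<forall>u. 0 \<le> a u)"
  unfolding pos_roots_def using root_coord(2)[of a] by force

lemma P_in_R: "a \<in> P \<Longrightarrow> a \<in> R"
  by (simp add: P_iff)

lemma not_both_pos: "a \<in> P \<Longrightarrow> - a \<notin> P"
proof
  assume "a \<in> P" "- a \<in> P"
  then have "a u = 0" for u by (auto simp: P_iff intro: antisym)
  then have "a = 0" by (intro ext) simp
  then show False using root_ne_zero[of a] \<open>a \<in> P\<close> by (simp add: P_in_R)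
qed

lemma act_simple_pos:
  assumes "w \<in> carrier G" "s \<in> S"
  shows "act w (simple_root s) \<in> P \<longleftrightarrow> len w < len (w \<otimes> s)"
proof -
  have up: "act v (simple_root s) \<in> P" if "v \<in> carrier G" "len v < len (v \<otimes> s)" for v
    using that assms ascent_nonneg[OF that(1) assms(2) that(2)]
    by (simp add: P_iff act_root simple_in_R)
  have "act w (simple_root s) \<notin> P" if "\<not> len w < len (w \<otimes> s)"
  proof -
    have "len (w \<otimes> s) < len (w \<otimes> s \<otimes> s)"
      using that len_right[OF assms] assms by (auto simp: gen_cancel)
    then have "act (w \<otimes> s) (simple_root s) \<in> P" using assms by (intro up) (auto simp: gen_closed)
    then have "- act w (simple_root s) \<in> P"
      using assms by (simp add: act_mult gen_closed act_gen_self act_minus)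
    then show ?thesis using not_both_pos[of "act w (simple_root s)"] by argo
  qed
  then show ?thesis using up assms by blast
qed

lemma pos_or_neg: "a \<in> R \<Longrightarrow> a \<in> P \<or> - a \<in> P"
proof (erule rootE)
  fix w s assume *: "w \<in> carrier G" "s \<in> S" "a = act w (simple_root s)"
  have "- a = act (w \<otimes> s) (simple_root s)"
    using * by (simp add: act_mult gen_closed act_gen_self act_minus)
  then show ?thesis
    using * act_simple_pos[of w s] act_simple_pos[of "w \<otimes> s" s] len_right[of w s]
    by (auto simp: gen_closed gen_cancel)
qed

lemma neg_in_P_iff: "a \<in> R \<Longrightarrow> - a \<in> P \<longleftrightarrow> a \<notin> P"
  using pos_or_neg[of a] not_both_pos[of a] by metis

lemma simple_in_P: "s \<in> S \<Longrightarrow> simple_root s \<in> P"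
  using simple_in_R[of s] by (simp add: P_iff) (simp add: simple_root_def)

lemma finite_P: "finite P"
  by (rule finite_subset[OF _ finite_R]) (auto intro: P_in_R)

lemma pos_add: "a \<in> P \<Longrightarrow> b \<in> P \<Longrightarrow> a + b \<in> R \<Longrightarrow> a + b \<in> P"
  by (simp add: P_iff)

lemma nonpos_add:
  assumes "a \<in> R" "b \<in> R" "a + b \<in> R" "a \<notin> P" "b \<notin> P"
  shows "a + b \<notin> P"
proof -
  have "- a \<in> P" "- b \<in> P" using assms by (simp_all add: neg_in_P_iff)
  moreover have "- (a + b) = - a + - b" by (rule ext) simp
  ultimately have "- (a + b) \<in> P"
    using pos_add[of "- a" "- b"] neg_root[OF assms(3)] by presburger
  then show ?thesis using not_both_pos[of "a + b"] by argo
qed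

text \<open>A positive root other than \<alpha>(s) has a positive coordinate different from s, and s leaves that
coordinate alone.\<close>

lemma simple_perm:
  assumes "s \<in> S" "a \<in> P" "a \<noteq> simple_root s"
  shows "act s a \<in> P"
proof (rule ccontr)
  assume "act s a \<notin> P"
  moreover have "act s a \<in> R" using assms by (simp add: act_root gen_closed P_in_R)
  ultimately have neg: "- act s a \<in> P" by (simp add: neg_in_P_iff)
  have "a u = 0" if "u \<noteq> s" for u
  proof -
    have "act s a u = a u"
      using that assms by (simp add: act_gen reflect_def simple_root_def)
    moreover have "0 \<le> (- act s a) u" using neg unfolding P_iff by blast
    moreover have "0 \<le> a u" using assms unfolding P_iff by blast
    ultimately show ?thesis by simp
  qed
  moreover define c where "c = a s"
  ultimately have a: "a = c \<cdot> simple_root s" by (intro ext) (simp add: simple_root_def)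
  have "ip a a = c * (c * 2)"
    unfolding a using assms by (simp add: ip_linear simple_norm)
  then have "c * c = 1" using root_norm[of a] assms P_in_R by simp
  moreover have "0 \<le> c" using assms unfolding P_iff c_def by blast
  ultimately have "c = 1"
    using square_eq_1_iff[of c] by auto
  then have "a = simple_root s" unfolding a by (intro ext) simp
  then show False using assms by simp
qed

lemma act_faithful:
  assumes "v \<in> carrier G" "w \<in> carrier G" "\<And>x. act v x = act w x"
  shows "v = w"
proof -
  define z where "z = inv w \<otimes> v"
  have z: "z \<in> carrier G" "act z x = x" for x
    using assms by (simp_all add: z_def act_mult)
  have "z = \<one>"
  proof (rule ccontr)
    assume "z \<noteq> \<one>"
    then obtain s where s: "s \<in> S" "len (z \<otimes> s) < len z"
      using right_descent_exists[OF z(1)] by blast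
    then show False using act_simple_pos[OF z(1) s(1)] z simple_in_P[OF s(1)] by simp
  qed
  then show ?thesis using assms by (metis inv_closed inv_equality inv_inv z_def)
qed

definition rt :: "('a \<Rightarrow> real) \<Rightarrow> 'a" where
  "rt a = (THE t. t \<in> carrier G \<and> (\<forall>v. act t v = reflect a v))"

lemma rt_unique:
  assumes "t \<in> carrier G" "\<And>v. act t v = reflect a v"
  shows "rt a = t"
  unfolding rt_def
proof (rule the_equality)
  fix t' assume "t' \<in> carrier G \<and> (\<forall>v. act t' v = reflect a v)"
  then show "t' = t" using assms by (intro act_faithful) auto
qed (use assms in auto)

lemma rt_conj:
  assumes "w \<in> carrier G" "s \<in> S"
  shows "rt (act w (simple_root s)) = w \<otimes> s \<otimes> inv w"
  by (rule rt_unique) (use assms in \<open>simp_all add: gen_closed act_mult act_gen act_reflect\<close>)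

lemma rt_closed [simp]: "a \<in> R \<Longrightarrow> rt a \<in> carrier G"
  by (erule rootE) (simp add: rt_conj gen_closed)

lemma act_rt: "a \<in> R \<Longrightarrow> act (rt a) v = reflect a v"
  by (erule rootE) (simp add: rt_conj gen_closed act_mult act_gen act_reflect)

lemma rt_in_reflections: "a \<in> R \<Longrightarrow> rt a \<in> reflections G S"
  by (erule rootE) (auto simp: rt_conj reflections_def)

lemma rt_simple: "s \<in> S \<Longrightarrow> rt (simple_root s) = s"
  by (rule rt_unique) (simp_all add: gen_closed act_gen)

lemma rt_neg: "a \<in> R \<Longrightarrow> rt (- a) = rt a"
proof (rule rt_unique)
  fix v assume a: "a \<in> R"
  show "act (rt a) v = reflect (- a) v"
    unfolding act_rt[OF a] by (rule ext) (simp add: reflect_def ip_linear)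
qed simp

lemma reflectionE:
  assumes "t \<in> reflections G S"
  obtains a where "a \<in> P" "t = rt a"
proof -
  obtain w s where w: "w \<in> carrier G" "s \<in> S" "t = w \<otimes> s \<otimes> inv w"
    using assms by (auto simp: reflections_def)
  define a where "a = act w (simple_root s)"
  have a: "a \<in> R" "t = rt a" using w by (simp_all add: a_def act_root simple_in_R rt_conj)
  show ?thesis
  proof (cases "a \<in> P")
    case False
    then have "- a \<in> P" "t = rt (- a)" using a by (simp_all add: neg_in_P_iff rt_neg)
    then show ?thesis by (rule that)
  qed (use a that in blast)
qed

lemma act_rt_self: "a \<in> R \<Longrightarrow> act (rt a) a = - a"
  by (rule ext) (simp add: act_rt reflect_def root_norm)

lemma rt_move:
  assumes "w \<in> carrier G" "a \<in> R"
  shows "w \<otimes> rt a = rt (act w a) \<otimes> w"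
  by (rule act_faithful) (use assms in \<open>simp_all add: act_mult act_rt act_root act_reflect\<close>)

lemma rt_square: "a \<in> R \<Longrightarrow> rt a \<otimes> rt a = \<one>"
  by (rule act_faithful) (simp_all add: act_mult act_rt reflect_involution root_norm)

lemma rt_cancel: "w \<in> carrier G \<Longrightarrow> a \<in> R \<Longrightarrow> w \<otimes> rt a \<otimes> rt a = w"
  by (simp add: m_assoc rt_square)

text \<open>Strip letters from the left of w. At the letter s where the image of a changes sign, this image is
\<alpha>(s), and then deleting the letter is the same as multiplying by the reflection of a on the right.\<close>

lemma strong_exchange:
  assumes "w \<in> carrier G" "a \<in> P" "act w a \<notin> P"
  shows "len (w \<otimes> rt a) < len w"
  using assms(1,3)
proof (induction "len w" arbitrary: w rule: less_induct)
  case less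
  note w = less.prems(1)
  have a: "a \<in> R" using assms P_in_R by blast
  have "w \<noteq> \<one>" using less.prems assms by auto
  then obtain s where s: "s \<in> S" "len (s \<otimes> w) < len w" using left_descent_exists[OF w] by blast
  define v where "v = s \<otimes> w"
  have v: "v \<in> carrier G" "len v < len w" "w = s \<otimes> v"
    using s w by (auto simp: v_def gen_closed gen_cancel_left)
  show ?case
  proof (cases "act v a \<in> P")
    case True
    have "act w a = act s (act v a)" using v s by (simp add: act_mult gen_closed)
    then have "act v a = simple_root s" using simple_perm[OF s(1) True] less.prems by auto
    then have "v \<otimes> rt a = w" using rt_move[OF v(1) a] s v by (simp add: rt_simple)
    then have "w \<otimes> rt a = v" using rt_cancel[OF v(1) a] by simp
    then show ?thesis using v by simp
  next
    case False
    have "len (v \<otimes> rt a) < len v" using less.hyps[OF v(2) v(1) False] .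
    moreover have "w \<otimes> rt a = s \<otimes> (v \<otimes> rt a)" using v s a by (simp add: m_assoc gen_closed)
    then have "len (w \<otimes> rt a) \<le> Suc (len (v \<otimes> rt a))"
      using len_left[of "v \<otimes> rt a" s] v s a by auto
    ultimately show ?thesis using v by simp
  qed
qed

lemma len_rt_iff:
  assumes "w \<in> carrier G" "a \<in> P"
  shows "len w < len (w \<otimes> rt a) \<longleftrightarrow> act w a \<in> P"
proof
  have a: "a \<in> R" using assms P_in_R by blast
  show "act w a \<in> P" if "len w < len (w \<otimes> rt a)"
    using strong_exchange[OF assms] that by linarith
  assume "act w a \<in> P"
  then have "act (w \<otimes> rt a) a \<notin> P"
    using assms a not_both_pos[of "act w a"] by (auto simp: act_mult act_rt_self act_minus)
  then show "len w < len (w \<otimes> rt a)"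
    using strong_exchange[of "w \<otimes> rt a" a] assms a by (simp add: rt_cancel)
qed

lemma rt_inj:
  assumes "a \<in> P" "b \<in> P" "rt a = rt b"
  shows "a = b"
proof -
  have R: "a \<in> R" "b \<in> R" using assms P_in_R by auto
  have "- a = reflect b a" using act_rt_self[OF R(1)] act_rt[OF R(2)] assms(3) by simp
  then have *: "- a u = a u - ip b a * b u" for u
    by (metis fun_Compl_def minus_apply reflect_def scale_apply uminus_apply)
  define c where "c = ip b a / 2"
  have a: "a = c \<cdot> b"
  proof (rule ext)
    show "a u = (c \<cdot> b) u" for u using *[of u] by (simp add: c_def field_simps)
  qed
  have "ip a a = c * (c * ip b b)" unfolding a by (simp add: ip_linear)
  then have "c * c = 1" using R by (simp add: root_norm)
  then have "c = 1 \<or> c = -1" using square_eq_1_iff[of c] by simp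
  moreover have "c \<noteq> -1"
  proof
    assume "c = -1"
    then have "- b = a" unfolding a by (intro ext) simp
    then show False using assms not_both_pos[of b] by argo
  qed
  ultimately have "c = 1" by blast
  then show ?thesis unfolding a by (intro ext) simp
qed

section \<open>Arithmetic of roots\<close>

lemma reflect_root: "a \<in> R \<Longrightarrow> b \<in> R \<Longrightarrow> reflect a b \<in> R"
  using act_root[of "rt a" b] by (simp add: act_rt)

text \<open>In a finite root system the form takes a largest value c on pairs of roots. Reflecting such a pair
produces the value c * c - 2, which exceeds c as soon as c > 2.\<close>

lemma ip_le_2:
  assumes "a \<in> R" "b \<in> R"
  shows "ip a b \<le> 2"
proof (rule ccontr)
  assume gt: "\<not> ip a b \<le> 2"
  define I where "I = (\<lambda>(a, b). ip a b) ` (R \<times> R)"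
  have I: "finite I" "ip a b \<in> I" using finite_R assms by (auto simp: I_def)
  then have "Max I \<in> I" by (intro Max_in) auto
  then obtain c d where cd: "c \<in> R" "d \<in> R" "ip c d = Max I" by (auto simp: I_def)
  have big: "ip c d > 2" using Max_ge[OF I] gt cd by linarith
  \<comment> \<open>The pair witnessing a value larger than the maximum.\<close>
  have "ip (- reflect d c) c = ip c d * ip c d - 2"
    using cd by (simp add: reflect_def ip_linear root_norm ip_sym[of d c])
  moreover have "ip (- reflect d c) c \<in> I"
    using cd reflect_root neg_root by (auto simp: I_def intro!: image_eqI[where x = "(- reflect d c, c)"])
  ultimately have "ip c d * ip c d - 2 \<le> ip c d" using Max_ge[OF I(1)] cd by metis
  moreover have "2 * ip c d < ip c d * ip c d" using big by simp
  ultimately show False using big by linarith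
qed

text \<open>Otherwise all points b + n (a - b) would be roots, since each is minus the reflection of its
second predecessor in its predecessor.\<close>

lemma ip_eq_2:
  assumes "a \<in> R" "b \<in> R" "ip a b = 2"
  shows "a = b"
proof (rule ccontr)
  assume "a \<noteq> b"
  then obtain u where u: "a u \<noteq> b u" by (meson ext)
  define r where "r n = b + real n \<cdot> (a - b)" for n :: nat
  have r2: "ip (r m) (r n) = 2" for m n
    unfolding r_def by (simp add: ip_linear root_norm assms ip_sym[of b a])
  have "r n \<in> R \<and> r (Suc n) \<in> R" for n
  proof (induction n)
    case 0
    have "r 0 = b" "r (Suc 0) = a" by (auto simp: r_def intro!: ext)
    then show ?case using assms by simp
  next
    case (Suc n)
    have "r (Suc (Suc n)) = - reflect (r (Suc n)) (r n)"
      unfolding reflect_def r2 by (rule ext) (simp add: r_def algebra_simps)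
    moreover have "reflect (r (Suc n)) (r n) \<in> R" using Suc reflect_root by blast
    ultimately have "r (Suc (Suc n)) \<in> R" using neg_root by metis
    then show ?case using Suc by blast
  qed
  then have "range r \<subseteq> R" by blast
  then have "finite (range r)" using finite_R finite_subset by blast
  moreover have "inj r"
  proof (rule injI)
    fix m n assume "r m = r n"
    then have "r m u = r n u" by simp
    then show "m = n" using u by (simp add: r_def)
  qed
  ultimately show False using finite_imageD infinite_UNIV_nat by blast
qed

lemma ip_cases:
  assumes "a \<in> R" "b \<in> R" "a \<noteq> b" "a \<noteq> - b"
  shows "ip a b = -1 \<or> ip a b = 0 \<or> ip a b = 1"
proof -
  have "ip a b \<noteq> 2" using ip_eq_2 assms by blast
  moreover have "ip a b \<noteq> -2"
    using ip_eq_2[of a "- b"] assms by (auto simp: ip_minus_right neg_root)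
  moreover have "ip a b \<le> 2" "- ip a b \<le> 2"
    using ip_le_2[of a b] ip_le_2[of a "- b"] assms by (auto simp: ip_minus_right neg_root)
  moreover obtain k where "ip a b = of_int k"
    using ip_root_int[OF assms(1,2)] by (rule Ints_cases)
  ultimately have "k \<noteq> 2" "k \<noteq> -2" "k \<le> 2" "- k \<le> 2" by auto
  then have "k = -1 \<or> k = 0 \<or> k = 1" by linarith
  then show ?thesis using \<open>ip a b = of_int k\<close> by auto
qed

lemma ip_cases_pos:
  assumes "a \<in> P" "b \<in> P" "a \<noteq> b"
  shows "ip a b = -1 \<or> ip a b = 0 \<or> ip a b = 1"
proof (rule ip_cases)
  show "a \<noteq> - b" using assms not_both_pos[of b] by auto
qed (use assms P_in_R in auto)

lemma sum_of_roots:
  assumes "a \<in> R" "b \<in> R" "ip a b = -1"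
  shows "a + b \<in> R"
proof -
  have "reflect a b = a + b" unfolding reflect_def assms(3) by (rule ext) simp
  then show ?thesis using reflect_root[OF assms(1,2)] by simp
qed

lemma ip_of_summands:
  assumes "a \<in> R" "b \<in> R" "a + b \<in> R"
  shows "ip a b = -1"
  using root_norm[OF assms(1)] root_norm[OF assms(2)] root_norm[OF assms(3)] ip_sym[of a b]
  by (simp add: ip_linear del: plus_fun_apply)

text \<open>The sum of the coordinates of a root is an integer; it is truncated to a natural number, which loses
nothing for positive roots and makes it available as an induction measure.\<close>

definition ht :: "('a \<Rightarrow> real) \<Rightarrow> nat" where
  "ht a = nat \<lfloor>\<Sum>s\<in>S. a s\<rfloor>"

lemma ht_real: "a \<in> P \<Longrightarrow> real (ht a) = (\<Sum>s\<in>S. a s)"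
proof -
  assume a: "a \<in> P"
  have "(\<Sum>s\<in>S. a s) \<in> \<int>" using a root_coord(1) P_in_R by (intro Ints_sum) blast
  moreover have "0 \<le> (\<Sum>s\<in>S. a s)" using a by (intro sum_nonneg) (simp add: P_iff)
  ultimately show ?thesis unfolding ht_def by (auto elim: Ints_cases)
qed

lemma ht_pos: "a \<in> P \<Longrightarrow> 0 < ht a"
proof (rule ccontr)
  assume a: "a \<in> P" and "\<not> 0 < ht a"
  then have "(\<Sum>s\<in>S. a s) = 0" using ht_real[OF a] by simp
  then have z: "a s = 0" if "s \<in> S" for s
    using that a finite_gens sum_nonneg_eq_0_iff[of S a] by (auto simp: P_iff)
  have "a u = 0" for u using z root_coord(2)[of a u] P_in_R[OF a] by blast
  then have "a = 0" by (intro ext) simp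
  then show False using root_ne_zero[of a] P_in_R[OF a] by simp
qed

lemma ht_add: "a \<in> P \<Longrightarrow> b \<in> P \<Longrightarrow> a + b \<in> P \<Longrightarrow> ht (a + b) = ht a + ht b"
proof -
  assume *: "a \<in> P" "b \<in> P" "a + b \<in> P"
  have "real (ht (a + b)) = real (ht a) + real (ht b)"
    unfolding ht_real[OF *(1)] ht_real[OF *(2)] ht_real[OF *(3)] by (simp add: sum.distrib)
  then show ?thesis by linarith
qed

text \<open>The norm 2 of a is the sum of its nonnegative coordinates weighted with the products of a with the
simple roots. So some simple root has a positive product with a, and this product is 1 unless a is
that simple root.\<close>

lemma simple_or_descends:
  assumes "a \<in> P"
  obtains (simple) s where "s \<in> S" "a = simple_root s"
    | (descends) s b where "s \<in> S" "b \<in> P" "a = b + simple_root s" "act s a = b"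
proof -
  have "\<exists>s\<in>S. 0 < ip (simple_root s) a"
  proof (rule ccontr)
    assume "\<not> ?thesis"
    then have "(\<Sum>s\<in>S. a s * ip (simple_root s) a) \<le> 0"
      using assms by (intro sum_nonpos mult_nonneg_nonpos) (auto simp: P_iff not_less)
    then show False using ip_as_sum[of a a] root_norm[of a] P_in_R assms by simp
  qed
  then obtain s where s: "s \<in> S" "0 < ip (simple_root s) a" by blast
  show ?thesis
  proof (cases "a = simple_root s")
    case True
    then show ?thesis using simple s by blast
  next
    case False
    then have "ip (simple_root s) a = 1"
      using ip_cases_pos[of "simple_root s" a] s assms by (auto simp: simple_in_P)
    then have "a = act s a + simple_root s"
      unfolding act_gen[OF s(1)] reflect_def by (intro ext) simp
    then show ?thesis using descends[of s "act s a"] simple_perm[OF s(1) assms False] s by blast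
  qed
qed

section \<open>Bruhat order and lifting\<close>

abbreviation step :: "'a \<Rightarrow> 'a \<Rightarrow> bool" where "step \<equiv> bruhat_step G S"
abbreviation le :: "'a \<Rightarrow> 'a \<Rightarrow> bool" (infix "\<sqsubseteq>" 50) where "le \<equiv> bruhat_le G S"

lemma stepI: "u \<in> carrier G \<Longrightarrow> a \<in> P \<Longrightarrow> act u a \<in> P \<Longrightarrow> step u (u \<otimes> rt a)"
  unfolding bruhat_step_def using rt_in_reflections P_in_R len_rt_iff by blast

lemma stepE:
  assumes "step u v"
  obtains a where "u \<in> carrier G" "a \<in> P" "v = u \<otimes> rt a" "act u a \<in> P"
proof -
  obtain t where t: "u \<in> carrier G" "t \<in> reflections G S" "v = u \<otimes> t" "len u < len v"
    using assms unfolding bruhat_step_def by blast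
  then obtain a where "a \<in> P" "t = rt a" using reflectionE by blast
  then show ?thesis using that t len_rt_iff by blast
qed

lemma step_closed: "step u v \<Longrightarrow> u \<in> carrier G" "step u v \<Longrightarrow> v \<in> carrier G"
  by (auto elim!: stepE simp: P_in_R)

lemma step_len: "step u v \<Longrightarrow> len u < len v"
  by (simp add: bruhat_step_def)

lemma step_le: "step u v \<Longrightarrow> u \<sqsubseteq> v"
  by (simp add: bruhat_le_def step_closed r_into_rtranclp)

lemma le_refl: "u \<in> carrier G \<Longrightarrow> u \<sqsubseteq> u"
  by (simp add: bruhat_le_def)

lemma le_trans: "u \<sqsubseteq> v \<Longrightarrow> v \<sqsubseteq> w \<Longrightarrow> u \<sqsubseteq> w"
  by (auto simp: bruhat_le_def)

lemma le_closed: "u \<sqsubseteq> v \<Longrightarrow> u \<in> carrier G" "u \<sqsubseteq> v \<Longrightarrow> v \<in> carrier G"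
  by (simp_all add: bruhat_le_def)

lemma le_cases:
  assumes "u \<sqsubseteq> v"
  obtains "u = v" | w where "step u w" "w \<sqsubseteq> v"
proof -
  have "step\<^sup>*\<^sup>* u v" using assms by (simp add: bruhat_le_def)
  then show ?thesis
  proof (cases rule: converse_rtranclpE)
    case (step w)
    then show ?thesis using that(2)[of w] assms step_closed by (simp add: bruhat_le_def)
  qed (rule that(1))
qed

lemma le_len: "u \<sqsubseteq> v \<Longrightarrow> len u \<le> len v"
proof -
  assume "u \<sqsubseteq> v"
  then have "step\<^sup>*\<^sup>* u v" by (simp add: bruhat_le_def)
  then show ?thesis by induction (auto dest: step_len)
qed

lemma le_len_eq: "u \<sqsubseteq> v \<Longrightarrow> len v \<le> len u \<Longrightarrow> u = v"
  by (erule le_cases) (fastforce dest: step_len le_len)+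

lemma less_rt_iff:
  assumes "w \<in> carrier G" "a \<in> P"
  shows "bruhat_less G S w (w \<otimes> rt a) \<longleftrightarrow> act w a \<in> P"
proof
  assume "act w a \<in> P"
  then show "bruhat_less G S w (w \<otimes> rt a)"
    using step_le[OF stepI[OF assms]] len_rt_iff[OF assms] by (auto simp: bruhat_less_def)
next
  assume "bruhat_less G S w (w \<otimes> rt a)"
  then have "len w < len (w \<otimes> rt a)"
    using le_len_eq[of w "w \<otimes> rt a"] by (force simp: bruhat_less_def)
  then show "act w a \<in> P" using len_rt_iff[OF assms] by blast
qed

lemma rt_less_iff:
  assumes "w \<in> carrier G" "a \<in> P"
  shows "bruhat_less G S (w \<otimes> rt a) w \<longleftrightarrow> act w a \<notin> P"
proof -
  have a: "a \<in> R" using assms P_in_R by blast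
  have "act (w \<otimes> rt a) a = - act w a"
    using assms a by (simp add: act_mult act_rt_self act_minus)
  then show ?thesis
    using less_rt_iff[of "w \<otimes> rt a" a] assms a neg_in_P_iff[of "act w a"]
    by (simp add: rt_cancel act_root)
qed

text \<open>Left and right multiplication by a generator share the lifting property; this predicate
  collects what its proof uses.\<close>

definition lifting :: "('a \<Rightarrow> 'a) \<Rightarrow> bool" where
  "lifting f \<longleftrightarrow>
     (\<forall>u\<in>carrier G. f u \<in> carrier G \<and> f (f u) = u \<and> (len u < len (f u) \<longrightarrow> step u (f u))) \<and>
     (\<forall>u v. step u v \<longrightarrow> step (f u) (f v) \<or> v = f u)"

lemma lifting_right:
  assumes s: "s \<in> S"
  shows "lifting (\<lambda>w. w \<otimes> s)"
  unfolding lifting_def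
proof (intro conjI ballI allI impI)
  fix u assume u: "u \<in> carrier G"
  then show "u \<otimes> s \<in> carrier G" "u \<otimes> s \<otimes> s = u" using s by (auto simp: gen_closed gen_cancel)
  assume "len u < len (u \<otimes> s)"
  then have "act u (simple_root s) \<in> P" using u s act_simple_pos by blast
  from stepI[OF u simple_in_P[OF s] this] show "step u (u \<otimes> s)" using s by (simp add: rt_simple)
next
  fix u v assume "step u v"
  then obtain a where a: "u \<in> carrier G" "a \<in> P" "v = u \<otimes> rt a" "act u a \<in> P" by (rule stepE)
  show "step (u \<otimes> s) (v \<otimes> s) \<or> v = u \<otimes> s"
  proof (cases "a = simple_root s")
    case True
    then show ?thesis using a s by (simp add: rt_simple)
  next
    case False
    have sa: "act s a \<in> P" using simple_perm[OF s a(2) False] .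
    have ss: "act s (act s a) = a"
      using s by (simp add: act_gen reflect_involution simple_norm)
    then have "act (u \<otimes> s) (act s a) \<in> P" using a s by (simp add: act_mult gen_closed)
    moreover have "s \<otimes> rt (act s a) = rt a \<otimes> s"
      using rt_move[of s "act s a"] s sa ss by (simp add: gen_closed P_in_R)
    then have "u \<otimes> s \<otimes> rt (act s a) = v \<otimes> s"
      using a s sa by (simp add: m_assoc gen_closed P_in_R)
    ultimately show ?thesis using stepI[of "u \<otimes> s" "act s a"] a s sa by (simp add: gen_closed)
  qed
qed

lemma lifting_left:
  assumes s: "s \<in> S"
  shows "lifting (\<lambda>w. s \<otimes> w)"
  unfolding lifting_def
proof (intro conjI ballI allI impI)
  fix u assume u: "u \<in> carrier G"
  then show "s \<otimes> u \<in> carrier G" "s \<otimes> (s \<otimes> u) = u"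
    using s by (auto simp: gen_closed gen_cancel_left)
  define a where "a = act (inv u) (simple_root s)"
  have a: "a \<in> R" "act u a = simple_root s"
    using u s by (auto simp: a_def act_root simple_in_R)
  then have us: "s \<otimes> u = u \<otimes> rt a" using rt_move[OF u a(1)] s by (simp add: rt_simple)
  assume lt: "len u < len (s \<otimes> u)"
  have "a \<in> P"
  proof (rule ccontr)
    assume "a \<notin> P"
    then have na: "- a \<in> P" using a by (simp add: neg_in_P_iff)
    have "act u (- a) \<in> P" using lt us len_rt_iff[OF u na] a by (simp add: rt_neg)
    then show False using a u simple_in_P[OF s] not_both_pos by (simp add: act_minus)
  qed
  then show "step u (s \<otimes> u)" using stepI[OF u] a us simple_in_P[OF s] by simp
next
  fix u v assume "step u v"
  then obtain a where a: "u \<in> carrier G" "a \<in> P" "v = u \<otimes> rt a" "act u a \<in> P" by (rule stepE)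
  have aR: "a \<in> R" using a P_in_R by blast
  show "step (s \<otimes> u) (s \<otimes> v) \<or> v = s \<otimes> u"
  proof (cases "act u a = simple_root s")
    case True
    then show ?thesis using a s aR rt_move[of u a] by (simp add: rt_simple)
  next
    case False
    have "act (s \<otimes> u) a \<in> P"
      using simple_perm[OF s a(4) False] a s by (simp add: act_mult gen_closed)
    then show ?thesis using stepI[of "s \<otimes> u" a] a s aR by (simp add: m_assoc gen_closed)
  qed
qed

context
  fixes f assumes f: "lifting f"
begin

lemma lifting_invol: "u \<in> carrier G \<Longrightarrow> f u \<in> carrier G" "u \<in> carrier G \<Longrightarrow> f (f u) = u"
  using f by (auto simp: lifting_def)

lemma lifting_up: "u \<in> carrier G \<Longrightarrow> len u < len (f u) \<Longrightarrow> u \<sqsubseteq> f u"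
  using f step_le by (auto simp: lifting_def)

lemma lifting_down: "u \<in> carrier G \<Longrightarrow> len (f u) < len u \<Longrightarrow> f u \<sqsubseteq> u"
  using lifting_up[of "f u"] lifting_invol by simp

lemma lifting_le_source:
  assumes "x \<sqsubseteq> y"
  shows "f x \<sqsubseteq> f y \<or> f x \<sqsubseteq> y"
proof -
  have "step\<^sup>*\<^sup>* x y" "y \<in> carrier G" using assms by (simp_all add: bruhat_le_def)
  then show ?thesis
  proof (induction rule: converse_rtranclp_induct)
    case base
    then show ?case using lifting_invol le_refl by blast
  next
    case (step x z)
    then have "z \<sqsubseteq> y" using step_closed by (simp add: bruhat_le_def)
    then show ?case using step f step_le le_trans unfolding lifting_def by blast
  qed
qed

lemma lifting_le_target:
  assumes "x \<sqsubseteq> y"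
  shows "f x \<sqsubseteq> f y \<or> x \<sqsubseteq> f y"
proof -
  have "step\<^sup>*\<^sup>* x y" "x \<in> carrier G" using assms by (simp_all add: bruhat_le_def)
  then show ?thesis
  proof (induction rule: rtranclp_induct)
    case base
    then show ?case using lifting_invol le_refl by blast
  next
    case (step z y)
    then have z: "x \<sqsubseteq> z" "z \<in> carrier G" using step_closed by (auto simp: bruhat_le_def)
    from step(2) have "step (f z) (f y) \<or> y = f z" using f unfolding lifting_def by blast
    then show ?case
    proof
      assume "step (f z) (f y)"
      then show ?case using step z step_le le_trans by blast
    next
      assume "y = f z"
      then show ?case using z lifting_invol by simp
    qed
  qed
qed

lemma lifting_both_up: "x \<sqsubseteq> y \<Longrightarrow> len y < len (f y) \<Longrightarrow> f x \<sqsubseteq> f y"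
  using lifting_le_source lifting_up le_trans le_closed by blast

lemma lifting_both_down: "x \<sqsubseteq> y \<Longrightarrow> len (f x) < len x \<Longrightarrow> f x \<sqsubseteq> f y"
  using lifting_le_target lifting_down le_trans le_closed by blast

lemma lifting_source: "x \<sqsubseteq> y \<Longrightarrow> len (f y) < len y \<Longrightarrow> f x \<sqsubseteq> y"
  using lifting_le_source lifting_down le_trans le_closed by blast

lemma lifting_target: "x \<sqsubseteq> y \<Longrightarrow> len x < len (f x) \<Longrightarrow> x \<sqsubseteq> f y"
  using lifting_le_target lifting_up le_trans le_closed by blast

end

section \<open>Minimal inversions\<close>

definition below :: "('a \<Rightarrow> real) \<Rightarrow> ('a \<Rightarrow> real) \<Rightarrow> bool" where
  "below g a \<longleftrightarrow> g \<noteq> a \<and> (\<forall>u. g u \<le> a u)"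

text \<open>Minimality of the reflection of a for (x, y), expressed through signs of roots alone.\<close>

definition minimal_inversion :: "'a \<Rightarrow> 'a \<Rightarrow> ('a \<Rightarrow> real) \<Rightarrow> bool" where
  "minimal_inversion x y a \<longleftrightarrow> x \<in> carrier G \<and> y \<in> carrier G \<and>
     a \<in> P \<and> act x a \<in> P \<and> act y a \<notin> P \<and>
     (\<forall>g\<in>P. below g a \<longrightarrow> act y g \<notin> P \<longrightarrow> act x g \<notin> P)"

lemma below_sum:
  assumes "b \<in> P" "c \<in> P"
  shows "below b (b + c)" "below c (b + c)"
proof -
  have "b \<noteq> 0" "c \<noteq> 0" using assms root_ne_zero P_in_R by blast+
  moreover have "0 \<le> b u" "0 \<le> c u" for u using assms by (simp_all add: P_iff)
  ultimately show "below b (b + c)" "below c (b + c)" by (auto simp: below_def)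
qed

lemma act_sum_pos:
  assumes "z \<in> carrier G" "b \<in> R" "c \<in> R" "b + c \<in> R" "act z b \<in> P" "act z c \<in> P"
  shows "act z (b + c) \<in> P"
  using pos_add[of "act z b" "act z c"] act_root[OF assms(1,4)] assms by (simp add: act_add)

lemma act_sum_neg:
  assumes "z \<in> carrier G" "b \<in> R" "c \<in> R" "b + c \<in> R" "act z b \<notin> P" "act z c \<notin> P"
  shows "act z (b + c) \<notin> P"
  using nonpos_add[of "act z b" "act z c"] act_root[OF assms(1,4)] assms
  by (simp add: act_add act_root)

text \<open>As x makes a positive and y makes it negative, x cannot make both summands negative and y cannot
make both positive. Minimality says that a summand that y makes negative is made negative by x,
and this leaves two possibilities only.\<close>

lemma summands_agree:
  assumes min: "minimal_inversion x y a" and bc: "b \<in> P" "c \<in> P" "a = b + c"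
  shows "act x b \<in> P \<longleftrightarrow> act y b \<in> P" "act y b \<in> P \<longleftrightarrow> act y c \<notin> P"
proof -
  have R: "b \<in> R" "c \<in> R" "b + c \<in> R" and xy: "x \<in> carrier G" "y \<in> carrier G"
    using min bc P_in_R by (auto simp: minimal_inversion_def)
  have "\<not> (act x b \<notin> P \<and> act x c \<notin> P)"
    using act_sum_neg[OF xy(1) R] min bc by (auto simp: minimal_inversion_def)
  moreover have "\<not> (act y b \<in> P \<and> act y c \<in> P)"
    using act_sum_pos[OF xy(2) R] min bc by (auto simp: minimal_inversion_def)
  moreover have "act y b \<notin> P \<longrightarrow> act x b \<notin> P" "act y c \<notin> P \<longrightarrow> act x c \<notin> P"
    using min bc below_sum[OF bc(1,2)] by (auto simp: minimal_inversion_def)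
  ultimately show "act x b \<in> P \<longleftrightarrow> act y b \<in> P" "act y b \<in> P \<longleftrightarrow> act y c \<notin> P"
    by blast+
qed

lemma act_gen_twice: "s \<in> S \<Longrightarrow> act s (act s v) = v"
  by (simp add: act_gen reflect_involution simple_norm)

lemma act_right_gen: "z \<in> carrier G \<Longrightarrow> s \<in> S \<Longrightarrow> act (z \<otimes> s) v = act z (act s v)"
  by (simp add: act_mult gen_closed)

lemma rt_descend:
  assumes "z \<in> carrier G" "s \<in> S" "b \<in> R"
  shows "z \<otimes> s \<otimes> rt b \<otimes> s = z \<otimes> rt (act s b)"
proof -
  have "s \<otimes> rt b = rt (act s b) \<otimes> s" using assms by (intro rt_move) (simp_all add: gen_closed)
  then have "s \<otimes> rt b \<otimes> s = rt (act s b)"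
    using assms by (simp add: gen_cancel act_root gen_closed)
  then show ?thesis using assms by (simp add: m_assoc gen_closed)
qed

lemma act_descend:
  assumes "z \<in> carrier G" "s \<in> S" "b \<in> P" "b + simple_root s \<in> P" "act s (b + simple_root s) = b"
  shows "act (z \<otimes> s \<otimes> rt b) (simple_root s) = act z b"
proof -
  have R: "b \<in> R" "simple_root s \<in> R" "b + simple_root s \<in> R"
    using assms P_in_R simple_in_R by auto
  have "reflect b (simple_root s) = b + simple_root s"
    unfolding reflect_def ip_of_summands[OF R] by (rule ext) simp
  then show ?thesis using assms R by (simp add: act_mult act_rt gen_closed)
qed

text \<open>The inversions for (x s, y s) are the images under s of those for (x, y). A competitor g below b
is moved to s g, and s g = g - k \<alpha>(s) with k \<ge> -1, which is still below b + \<alpha>(s) = a.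
The simple root \<alpha>(s) itself is no competitor, as s moves x and y in the same direction.\<close>

lemma minimal_inversion_descend:
  assumes min: "minimal_inversion x y a"
    and s: "s \<in> S" and b: "b \<in> P" "a = b + simple_root s" "act s a = b"
  shows "minimal_inversion (x \<otimes> s) (y \<otimes> s) b"
proof -
  have xy: "x \<in> carrier G" "y \<in> carrier G" and a: "a \<in> P" "act x a \<in> P" "act y a \<notin> P"
    using min by (auto simp: minimal_inversion_def)
  have a': "a = simple_root s + b" using b(2) by (simp add: add.commute)
  have sb: "act s b = a" using b(3) act_gen_twice[OF s, of a] by simp
  have "act (x \<otimes> s) g \<notin> P" if g: "g \<in> P" "below g b" "act (y \<otimes> s) g \<notin> P" for g
  proof (cases "g = simple_root s")
    case True
    have "act x (simple_root s) \<in> P \<longleftrightarrow> act y (simple_root s) \<in> P"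
      by (rule summands_agree(1)[OF min simple_in_P[OF s] b(1) a'])
    moreover have "act (z \<otimes> s) g \<in> P \<longleftrightarrow> act z (simple_root s) \<notin> P" if "z \<in> carrier G" for z
      using that s True
      by (simp add: act_right_gen act_gen_self act_minus neg_in_P_iff act_root simple_in_R)
    ultimately show ?thesis using g xy by blast
  next
    case False
    have sg: "act s g \<in> P" using simple_perm[OF s g(1) False] .
    have "ip (simple_root s) g \<ge> -1"
      using ip_cases_pos[of "simple_root s" g] simple_in_P[OF s] g False by auto
    then have "act s g u \<le> a u" for u
    proof -
      have "0 \<le> (1 + ip (simple_root s) g) * simple_root s u"
        using \<open>ip (simple_root s) g \<ge> -1\<close> by (simp add: simple_root_def)
      moreover have "g u \<le> b u" using g by (simp add: below_def)
      ultimately show ?thesis using s b(2) by (simp add: act_gen reflect_def algebra_simps)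
    qed
    moreover have "act s g \<noteq> a" using g b(3) act_gen_twice[OF s, of g] by (auto simp: below_def)
    ultimately have "below (act s g) a" by (simp add: below_def)
    then show ?thesis
      using min sg g s xy by (auto simp: minimal_inversion_def act_right_gen)
  qed
  then show ?thesis
    using xy a s b(1) sb by (simp add: minimal_inversion_def act_right_gen gen_closed)
qed

text \<open>Induction on the height of a, passing from (x, y, a) to (x s, y s, b) with a = b + \<alpha>(s). The sign
of b under y decides whether s is an ascent or a descent of the end points, and it is the same
direction for \<open>y \<otimes> rt a\<close>, so the conclusion can be translated back.\<close>

lemma generalized_lifting:
  assumes "x \<sqsubseteq> y" "minimal_inversion x y a"
  shows "x \<sqsubseteq> y \<otimes> rt a"
  using assms
proof (induction "ht a" arbitrary: x y a rule: less_induct)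
  case less
  note min = less.prems(2)
  have xy: "x \<in> carrier G" "y \<in> carrier G" and a: "a \<in> P" "act x a \<in> P" "act y a \<notin> P"
    using min by (auto simp: minimal_inversion_def)
  show ?case
  proof (cases rule: simple_or_descends[OF a(1)])
    case (1 s)
    then have "len x < len (x \<otimes> s)" using a xy act_simple_pos by blast
    then have "x \<sqsubseteq> y \<otimes> s" by (rule lifting_target[OF lifting_right[OF 1(1)] less.prems(1)])
    then show ?thesis using 1 by (simp add: rt_simple)
  next
    case (2 s b)
    note s = 2(1)
    note lift = lifting_right[OF s]
    have a': "a = simple_root s + b" using 2(3) by (simp add: add.commute)
    define x' where "x' = x \<otimes> s"
    define y' where "y' = y \<otimes> s"
    have xy': "x' \<in> carrier G" "y' \<in> carrier G" "x' \<otimes> s = x" "y' \<otimes> s = y"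
      using xy s by (simp_all add: x'_def y'_def gen_closed gen_cancel)
    have min': "minimal_inversion x' y' b"
      unfolding x'_def y'_def by (rule minimal_inversion_descend[OF min 2])
    have "ht a = ht b + ht (simple_root s)"
      using ht_add[OF 2(2) simple_in_P[OF s]] 2(3) a by simp
    then have ht: "ht b < ht a" using ht_pos[OF simple_in_P[OF s]] by simp
    have agree: "act x b \<in> P \<longleftrightarrow> act y b \<in> P" "act y b \<in> P \<longleftrightarrow> act y (simple_root s) \<notin> P"
      "act x (simple_root s) \<in> P \<longleftrightarrow> act y (simple_root s) \<in> P"
      using summands_agree[OF min 2(2) simple_in_P[OF s] 2(3)]
        summands_agree[OF min simple_in_P[OF s] 2(2) a'] by blast+
    have yt: "y' \<otimes> rt b \<otimes> s = y \<otimes> rt a"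
      using rt_descend[OF xy(2) s P_in_R[OF 2(2)]] 2(4) act_gen_twice[OF s, of a]
      unfolding y'_def by simp
    show ?thesis
    proof (cases "act x (simple_root s) \<in> P")
      case True
      then have "len x < len x'" "len y < len y'"
        using agree xy s unfolding x'_def y'_def by (simp_all add: act_simple_pos)
      then have "x' \<sqsubseteq> y'"
        using lifting_both_up[OF lift less.prems(1)] unfolding x'_def y'_def by blast
      then have "x' \<sqsubseteq> y' \<otimes> rt b" using less.hyps[OF ht _ min'] by blast
      then have "x' \<otimes> s \<sqsubseteq> y' \<otimes> rt b \<otimes> s"
        by (rule lifting_both_down[OF lift]) (use \<open>len x < len x'\<close> xy' in simp)
      then show ?thesis using xy' yt by simp
    next
      case False
      then have "len x' < len x"
        using act_simple_pos[OF xy(1) s] len_right[OF xy(1) s] unfolding x'_def by auto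
      then have "x' \<sqsubseteq> y'"
        using lifting_both_down[OF lift less.prems(1)] unfolding x'_def y'_def by blast
      then have le: "x' \<sqsubseteq> y' \<otimes> rt b" using less.hyps[OF ht _ min'] by blast
      have "act (y' \<otimes> rt b) (simple_root s) \<in> P"
        unfolding y'_def using act_descend[OF xy(2) s 2(2)] 2 a agree False by simp
      then have "len (y' \<otimes> rt b) < len (y' \<otimes> rt b \<otimes> s)"
        using act_simple_pos s xy' 2 P_in_R by simp
      then have "x' \<otimes> s \<sqsubseteq> y' \<otimes> rt b \<otimes> s" using lifting_both_up[OF lift le] by blast
      then show ?thesis using xy' yt by simp
    qed
  qed
qed

text \<open>For z making a positive, this is the condition under which no intermediate element fits between z
and its translate by the reflection of a.\<close>

definition splits :: "'a \<Rightarrow> ('a \<Rightarrow> real) \<Rightarrow> bool" where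
  "splits z a \<longleftrightarrow> (\<forall>b\<in>P. \<forall>c\<in>P. a = b + c \<longrightarrow> (act z b \<in> P \<longleftrightarrow> act z c \<notin> P))"

text \<open>Write a = b + \<alpha>(s) and replace z by z s. The condition passes to b, and it also says that s changes
the lengths of z and of its translate in the same direction.\<close>

lemma splits_cover:
  assumes "z \<in> carrier G" "a \<in> P" "act z a \<in> P" "splits z a"
  shows "len (z \<otimes> rt a) = Suc (len z)"
  using assms
proof (induction "ht a" arbitrary: z a rule: less_induct)
  case less
  note z = less.prems(1) and a = less.prems(2,3) and split = less.prems(4)
  show ?case
  proof (cases rule: simple_or_descends[OF a(1)])
    case (1 s)
    then have "len z < len (z \<otimes> s)" using a z act_simple_pos by blast
    then show ?thesis using len_right[OF z 1(1)] 1 by (simp add: rt_simple)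
  next
    case (2 s b)
    note s = 2(1)
    have R: "a \<in> R" "b \<in> R" "simple_root s \<in> R" using a 2 P_in_R simple_in_R by auto
    have sb: "act s b = a" using 2(4) act_gen_twice[OF s, of a] by simp
    define z' where "z' = z \<otimes> s"
    have z': "z' \<in> carrier G" "z' \<otimes> s = z"
      using z s by (simp_all add: z'_def gen_closed gen_cancel)
    have "ht a = ht b + ht (simple_root s)"
      using ht_add[OF 2(2) simple_in_P[OF s]] 2(3) a by simp
    then have ht: "ht b < ht a" using ht_pos[OF simple_in_P[OF s]] by simp
    have "act z' c \<in> P \<longleftrightarrow> act z' d \<notin> P" if cd: "c \<in> P" "d \<in> P" "b = c + d" for c d
    proof -
      have ns: "e \<noteq> simple_root s" if ef: "e \<in> P" "f \<in> P" "b = e + f" for e f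
      proof
        assume "e = simple_root s"
        moreover have "ip b (simple_root s) = -1"
          using ip_of_summands[OF R(2,3)] R(1) unfolding 2(3) .
        moreover have "ip e f = -1"
          using ip_of_summands[OF P_in_R[OF ef(1)] P_in_R[OF ef(2)]] R(2) unfolding ef(3) .
        moreover have "ip b e = ip e e + ip f e" unfolding ef(3) by (rule ip_add_left)
        ultimately show False using simple_norm[OF s] ip_sym[of e f] by simp
      qed
      have "c \<noteq> simple_root s" "d \<noteq> simple_root s"
        using ns[OF cd] ns[OF cd(2,1)] cd(3) add.commute[of c d] by simp_all
      then have "act s c \<in> P" "act s d \<in> P" using simple_perm[OF s] cd by auto
      moreover have "a = act s c + act s d"
        using sb act_add[OF gen_closed[OF s], of c d] unfolding cd(3) by simp
      ultimately have "act z (act s c) \<in> P \<longleftrightarrow> act z (act s d) \<notin> P"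
        using split unfolding splits_def by blast
      then show ?thesis unfolding z'_def act_right_gen[OF z s] .
    qed
    then have "splits z' b" unfolding splits_def by blast
    moreover have "act z' b \<in> P" using a sb z s unfolding z'_def by (simp add: act_right_gen)
    ultimately have IH: "len (z' \<otimes> rt b) = Suc (len z')"
      using less.hyps[OF ht z'(1) 2(2)] by blast
    have zt: "z' \<otimes> rt b \<otimes> s = z \<otimes> rt a"
      using rt_descend[OF z s R(2)] sb unfolding z'_def by simp
    have zb: "act z b \<in> P \<longleftrightarrow> act z (simple_root s) \<notin> P"
      using split 2(2,3) simple_in_P[OF s] unfolding splits_def by blast
    have "act (z' \<otimes> rt b) (simple_root s) = act z b"
      unfolding z'_def using act_descend[OF z s 2(2)] 2 a by simp
    then have up: "act z b \<in> P \<longleftrightarrow> len (z' \<otimes> rt b) < len (z \<otimes> rt a)"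
      using act_simple_pos[of "z' \<otimes> rt b" s] zt z' R s by simp
    have "len (z \<otimes> rt a) = Suc (len (z' \<otimes> rt b)) \<or> len (z' \<otimes> rt b) = Suc (len (z \<otimes> rt a))"
      using len_right[of "z' \<otimes> rt b" s] zt z' R s by simp
    moreover have "len z' = Suc (len z) \<or> len z = Suc (len z')"
      using len_right[OF z s] unfolding z'_def .
    moreover have "act z (simple_root s) \<in> P \<longleftrightarrow> len z < len z'"
      using act_simple_pos[OF z s] unfolding z'_def .
    ultimately show ?thesis using up zb IH by linarith
  qed
qed

section \<open>Saturated chains in cells\<close>

definition cell :: "('a \<Rightarrow> real) set \<Rightarrow> ('a \<Rightarrow> real) set \<Rightarrow> 'a set" where
  "cell F B = {z \<in> carrier G. (\<forall>g\<in>F. act z g \<notin> P) \<and> (\<forall>g\<in>B. act z g \<in> P)}"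

text \<open>Equivalently, the positive roots outside U are closed under addition.\<close>

definition coclosed :: "('a \<Rightarrow> real) set \<Rightarrow> bool" where
  "coclosed U \<longleftrightarrow> (\<forall>a\<in>P. \<forall>b\<in>P. a + b \<in> U \<longrightarrow> a \<in> U \<or> b \<in> U)"

definition link :: "'a set \<Rightarrow> 'a \<Rightarrow> 'a \<Rightarrow> bool" where
  "link K z z' \<longleftrightarrow> z \<in> K \<and> z' \<in> K \<and> step z z' \<and> len z' = Suc (len z)"

lemma cell_closed: "z \<in> cell F B \<Longrightarrow> z \<in> carrier G"
  by (simp add: cell_def)

lemma ht_simple_root: "s \<in> S \<Longrightarrow> ht (simple_root s) = 1"
  using finite_gens by (simp add: ht_def simple_root_def)

lemma simple_not_sum:
  assumes "s \<in> S" "a \<in> P" "b \<in> P"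
  shows "a + b \<noteq> simple_root s"
  using ht_add[of a b] ht_pos[of a] ht_pos[of b] ht_simple_root[of s] simple_in_P[of s] assms by auto

lemma left_ascent_root_pos:
  assumes "u \<in> carrier G" "s \<in> S" "len u < len (s \<otimes> u)" "g \<in> R" "act u g = simple_root s"
  shows "g \<in> P"
proof (rule ccontr)
  assume "g \<notin> P"
  then have "- g \<in> P" using assms by (simp add: neg_in_P_iff)
  moreover have "s \<otimes> u = u \<otimes> rt (- g)"
    using rt_move[of u g] assms by (simp add: rt_simple rt_neg)
  ultimately have "act u (- g) \<in> P" using len_rt_iff[of u "- g"] assms by simp
  then show False
    using assms not_both_pos[OF simple_in_P] by (simp add: act_minus)
qed

lemma left_descent_pos:
  assumes "v \<in> carrier G" "s \<in> S" "len (s \<otimes> v) < len v" "g \<in> P" "act v g \<in> P"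
  shows "act (s \<otimes> v) g \<in> P"
proof (rule ccontr)
  assume "act (s \<otimes> v) g \<notin> P"
  then have "act v g = simple_root s"
    using simple_perm[of s "act v g"] assms by (auto simp: act_mult gen_closed)
  then have "s \<otimes> v = v \<otimes> rt g" using rt_move[of v g] assms P_in_R by (simp add: rt_simple)
  then show False using len_rt_iff[of v g] assms by simp
qed

text \<open>The only new inversion that left multiplication by s can cause is the root r that u1 sends to \<alpha>(s).
Suppose that r lies in B. If u1 arises from u by the reflection of c, then u sends the reflection r' of r in c to \<alpha>(s), and r' is r, r - c
or r + c. The root r' is outside B because \<open>s \<otimes> u\<close> inverts it, and c is outside B because u1 inverts
it; as B is coclosed, the first two cases are impossible. In the third
\<alpha>(s) would be a sum of two positive roots.\<close>

lemma left_shift_stays: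
  assumes B: "coclosed B" "B \<subseteq> P"
    and link: "link (cell {} B) u u1"
    and s: "s \<in> S" "s \<otimes> u \<in> cell {} B" "len u < len (s \<otimes> u)"
  shows "s \<otimes> u1 \<in> cell {} B"
proof -
  let ?K = "cell {} B"
  have u: "u \<in> ?K" "u1 \<in> ?K" "u \<in> carrier G" "u1 \<in> carrier G"
    using link cell_closed by (auto simp: link_def)
  obtain c where c: "c \<in> P" "u1 = u \<otimes> rt c" "act u c \<in> P"
    using link by (auto simp: link_def elim: stepE)
  have cR: "c \<in> R" using c P_in_R by blast
  have "act (s \<otimes> u1) r \<in> P" if r: "r \<in> B" for r
  proof (rule ccontr)
    assume neg: "act (s \<otimes> u1) r \<notin> P"
    have rP: "r \<in> P" "r \<in> R" using r B P_in_R by auto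
    have pos: "act u1 r \<in> P" "act u r \<in> P" using u r by (auto simp: cell_def)
    then have "act u1 r = simple_root s"
      using neg simple_perm[OF s(1) pos(1)] s u by (auto simp: act_mult gen_closed)
    then have r': "act u (reflect c r) = simple_root s"
      using c cR u by (simp add: act_mult act_rt)
    have not_B: "g \<notin> B" if "act u g = simple_root s" for g
    proof
      assume "g \<in> B"
      then have "act (s \<otimes> u) g \<in> P" using s(2) by (simp add: cell_def)
      moreover have "act (s \<otimes> u) g = - simple_root s"
        using that s(1) u(3) by (simp add: act_mult gen_closed act_gen_self)
      ultimately show False using not_both_pos[OF simple_in_P[OF s(1)]] by simp
    qed
    have "act u1 c = - act u c" using c cR u by (simp add: act_mult act_rt_self act_minus)
    then have cB: "c \<notin> B" using u(2) not_both_pos[OF c(3)] by (auto simp: cell_def)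
    consider "ip c r = 0" | "ip c r = 1" | "ip c r = -1"
      using ip_cases_pos[OF c(1) rP(1)] cB r by auto
    then show False
    proof cases
      case 1
      then have "reflect c r = r" by (intro ext) (simp add: reflect_def)
      then show False using r' not_B r by simp
    next
      case 2
      have "reflect c r \<in> P"
        using left_ascent_root_pos[OF u(3) s(1,3) _ r'] reflect_root[OF cR rP(2)] by blast
      moreover have "reflect c r + c = r" unfolding reflect_def 2 by (intro ext) simp
      ultimately have "reflect c r \<in> B \<or> c \<in> B"
        using B(1) c(1) r unfolding coclosed_def by metis
      then show False using cB not_B r' by blast
    next
      case 3
      then have "reflect c r = r + c" by (intro ext) (simp add: reflect_def)
      then have "act u r + act u c = simple_root s" using r' u(3) by (simp add: act_add)
      then show False using simple_not_sum[OF s(1) pos(2) c(3)] by simp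
    qed
  qed
  then show ?thesis using u(4) s(1) by (simp add: cell_def gen_closed)
qed

text \<open>Multiply the chain by s as long as s is an ascent. If the chain reaches an element with descent s,
then by lifting this element is s times its predecessor, so that from there on the chain itself can
be followed up to w and completed by the step from w to \<open>s \<otimes> w\<close>.\<close>

lemma left_shift_chain:
  assumes B: "coclosed B" "B \<subseteq> P" and s: "s \<in> S"
    and chain: "(link (cell {} B))\<^sup>*\<^sup>* u w"
    and u: "s \<otimes> u \<in> cell {} B" "len u < len (s \<otimes> u)"
    and w: "w \<in> cell {} B" "s \<otimes> w \<in> cell {} B" "len w < len (s \<otimes> w)"
  shows "(link (cell {} B))\<^sup>*\<^sup>* (s \<otimes> u) (s \<otimes> w)"
  using chain u
proof (induction rule: converse_rtranclp_induct)
  case base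
  then show ?case by simp
next
  case (step u u1)
  let ?K = "cell {} B"
  note lift = lifting_left[OF s]
  have u: "u \<in> carrier G" "u1 \<in> carrier G" "step u u1" "len u1 = Suc (len u)"
    using step(1) cell_closed by (auto simp: link_def)
  have su1: "s \<otimes> u1 \<in> ?K" using left_shift_stays[OF B step(1) s step(4,5)] .
  show ?case
  proof (cases "len (s \<otimes> u1) < len u1")
    case True
    have "s \<otimes> u \<sqsubseteq> u1" using lifting_source[OF lift step_le[OF u(3)] True] .
    then have "s \<otimes> u = u1" using le_len_eq step(5) u(4) by simp
    moreover have "link ?K w (s \<otimes> w)"
      using w s cell_closed lift len_left[of w s] unfolding link_def lifting_def by auto
    ultimately show ?thesis using step(2) by simp
  next
    case False
    then have up: "len (s \<otimes> u1) = Suc (len u1)" using len_left[OF u(2) s] by auto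
    have "step (s \<otimes> u) (s \<otimes> u1) \<or> u1 = s \<otimes> u" using lift u(3) unfolding lifting_def by blast
    moreover have "u1 \<noteq> s \<otimes> u" using up u s by (auto simp: gen_cancel_left)
    ultimately have "link ?K (s \<otimes> u) (s \<otimes> u1)"
      using step(4,5) su1 up u len_left[OF u(1) s] unfolding link_def by auto
    moreover have "(link ?K)\<^sup>*\<^sup>* (s \<otimes> u1) (s \<otimes> w)" using step(3)[OF su1] up by simp
    ultimately show ?thesis by (rule converse_rtranclp_into_rtranclp)
  qed
qed

text \<open>Removing a left descent s from an element shrinks its set of inversions, so it does not leave the
cell. Hence induction on the length of v applies to (x, s v) or, if s is also a descent of x, to
(s x, s v).\<close>

lemma lower_cell_chain:
  assumes B: "coclosed B" "B \<subseteq> P"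
    and "x \<in> cell {} B" "v \<in> cell {} B" "x \<sqsubseteq> v"
  shows "(link (cell {} B))\<^sup>*\<^sup>* x v"
  using assms(3-)
proof (induction "len v" arbitrary: x v rule: less_induct)
  case less
  let ?K = "cell {} B"
  have xv: "x \<in> carrier G" "v \<in> carrier G" using less.prems cell_closed by auto
  show ?case
  proof (cases "v = \<one>")
    case True
    then have "x = v" using le_len_eq[OF less.prems(3)] by simp
    then show ?thesis by simp
  next
    case False
    then obtain s where s: "s \<in> S" "len (s \<otimes> v) < len v" using left_descent_exists xv by blast
    note lift = lifting_left[OF s(1)]
    have down: "s \<otimes> z \<in> ?K" if "z \<in> ?K" "len (s \<otimes> z) < len z" for z
      using that left_descent_pos[of z s] s(1) B(2) by (auto simp: cell_def gen_closed)
    have sv: "s \<otimes> v \<in> ?K" "s \<otimes> (s \<otimes> v) = v"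
      using down less.prems s xv by (auto simp: gen_cancel_left)
    show ?thesis
    proof (cases "len x < len (s \<otimes> x)")
      case True
      have "x \<sqsubseteq> s \<otimes> v" using lifting_target[OF lift less.prems(3) True] .
      then have "(link ?K)\<^sup>*\<^sup>* x (s \<otimes> v)" using less.hyps[OF s(2)] less.prems sv by blast
      moreover have "step (s \<otimes> v) v"
        using lift sv s cell_closed[OF sv(1)] unfolding lifting_def by metis
      then have "link ?K (s \<otimes> v) v"
        using sv less.prems s len_left[OF xv(2) s(1)] unfolding link_def by auto
      ultimately show ?thesis by (rule rtranclp.rtrancl_into_rtrancl)
    next
      case False
      then have sx: "len (s \<otimes> x) < len x" using len_left[OF xv(1) s(1)] by auto
      then have sxK: "s \<otimes> x \<in> ?K" "s \<otimes> (s \<otimes> x) = x"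
        using down less.prems s xv by (auto simp: gen_cancel_left)
      have "s \<otimes> x \<sqsubseteq> s \<otimes> v" using lifting_both_down[OF lift less.prems(3) sx] .
      then have "(link ?K)\<^sup>*\<^sup>* (s \<otimes> x) (s \<otimes> v)" using less.hyps[OF s(2)] sxK sv by blast
      from left_shift_chain[OF B s(1) this] show ?thesis
        using sxK sv sx s less.prems by simp
    qed
  qed
qed

lemma coclosed_translate:
  assumes U: "coclosed U" "U \<subseteq> P" and s: "s \<in> S"
  shows "coclosed (insert (simple_root s) (act s ` (U - {simple_root s})))"
  unfolding coclosed_def
proof (intro ballI impI)
  fix a b
  let ?r = "simple_root s"
  let ?U = "insert ?r (act s ` (U - {?r}))"
  assume a: "a \<in> P" and b: "b \<in> P" and "a + b \<in> ?U"
  moreover have "a + b \<noteq> ?r" using simple_not_sum[OF s a b] .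
  ultimately obtain g where g: "g \<in> U" "a + b = act s g" by auto
  show "a \<in> ?U \<or> b \<in> ?U"
  proof (cases "a = ?r \<or> b = ?r")
    case False
    have sum: "act s a + act s b = g"
      using g(2) act_add[OF gen_closed[OF s], of a b] act_gen_twice[OF s, of g] by simp
    have pos: "act s a \<in> P" "act s b \<in> P" using simple_perm[OF s] a b False by auto
    have "act s a \<in> U \<or> act s b \<in> U"
      using U(1) pos g(1) sum unfolding coclosed_def by metis
    moreover have "c \<in> ?U" if c: "c \<in> P" "act s c \<in> U" for c
    proof (cases "act s c = ?r")
      case True
      then have "c = - ?r" using act_gen_twice[OF s, of c] act_gen_self[OF s] by simp
      then show ?thesis using c not_both_pos[OF simple_in_P[OF s]] by simp
    next
      case False
      then show ?thesis
        using c act_gen_twice[OF s, of c] by (intro insertI2 image_eqI[of c _ "act s c"]) auto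
    qed
    ultimately show ?thesis using a b by blast
  qed auto
qed

text \<open>Here f has least height in F and is a sum of a root in B of greatest possible height and a root b.
If b = c + d, then a + c or a + d is a root, say a + c; as f = (a + c) + d, one of a + c and d lies
in U, and the choice of f and a excludes a + c.\<close>

lemma coclosed_extend:
  assumes U: "coclosed U" "f \<in> U" "U = F \<union> B"
    and f: "f \<in> P" "\<And>g. g \<in> F \<Longrightarrow> ht f \<le> ht g"
    and a: "a \<in> P" "\<And>a' b'. a' \<in> B \<Longrightarrow> a' \<in> P \<Longrightarrow> b' \<in> P \<Longrightarrow> a' + b' = f \<Longrightarrow> ht a' \<le> ht a"
    and b: "b \<in> P" "a + b = f"
  shows "coclosed (insert b U)"
proof -
  have main: "d \<in> U" if cd: "c \<in> P" "d \<in> P" "b = c + d" and neg: "ip a c < 0" for c d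
  proof (rule ccontr)
    assume d: "d \<notin> U"
    have "a \<noteq> c" using neg root_norm[of a] a P_in_R by auto
    then have "ip a c = -1" using ip_cases_pos[OF a(1) cd(1)] neg by auto
    then have ac: "a + c \<in> P" using sum_of_roots[of a c] pos_add a(1) cd(1) P_in_R by blast
    have f_eq: "f = (a + c) + d" using b cd by (simp add: add.assoc)
    then have "a + c \<in> U" using U(1,2) ac cd(2) d unfolding coclosed_def by metis
    moreover have "a + c \<notin> F"
    proof
      assume "a + c \<in> F"
      then have "ht f \<le> ht (a + c)" by (rule f(2))
      moreover have "ht f = ht (a + c) + ht d" using ht_add[OF ac cd(2)] f(1) f_eq by simp
      ultimately show False using ht_pos[OF cd(2)] by simp
    qed
    ultimately have "ht (a + c) \<le> ht a" using U(3) a(2)[of "a + c" d] ac cd(2) f_eq by blast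
    then show False using ht_add[OF a(1) cd(1) ac] ht_pos[OF cd(1)] by simp
  qed
  show ?thesis
    unfolding coclosed_def
  proof (intro ballI impI)
    fix c d assume cd: "c \<in> P" "d \<in> P" "c + d \<in> insert b U"
    show "c \<in> insert b U \<or> d \<in> insert b U"
    proof (cases "c + d = b")
      case True
      have "ip a b = -1" using ip_of_summands[of a b] a b f P_in_R by blast
      then have "ip a c + ip a d = -1" unfolding True[symmetric] ip_add_right .
      then have "ip a c < 0 \<or> ip a d < 0" by linarith
      then show ?thesis using main[of c d] main[of d c] cd True by (auto simp: add.commute)
    next
      case False
      then show ?thesis using U(1) cd unfolding coclosed_def by blast
    qed
  qed
qed

text \<open>If the elements of a cell have descent s, then right multiplication by s carries the cell to one
whose elements have ascent s, and it respects covers in both directions.\<close>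

lemma right_translate_chain:
  assumes s: "s \<in> S" and F: "simple_root s \<in> F" "F \<subseteq> P" "B \<subseteq> P"
    and chain: "(link (cell (act s ` (F - {simple_root s}))
        (insert (simple_root s) (act s ` B))))\<^sup>*\<^sup>* x v"
  shows "(link (cell F B))\<^sup>*\<^sup>* (x \<otimes> s) (v \<otimes> s)"
  using chain
proof induction
  case (step y z)
  let ?r = "simple_root s"
  let ?K = "cell (act s ` (F - {?r})) (insert ?r (act s ` B))"
  have yz: "y \<in> ?K" "z \<in> ?K" "step y z" "len z = Suc (len y)"
    using step(2) by (auto simp: link_def)
  have mem: "w \<otimes> s \<in> cell F B" "len (w \<otimes> s) = Suc (len w)" if w: "w \<in> ?K" for w
  proof -
    have wc: "w \<in> carrier G" "act w ?r \<in> P" using w by (auto simp: cell_def)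
    then show "len (w \<otimes> s) = Suc (len w)"
      using act_simple_pos[OF wc(1) s] len_right[OF wc(1) s] by auto
    have "act (w \<otimes> s) ?r \<notin> P"
      using wc s not_both_pos[OF wc(2)] by (simp add: act_right_gen act_gen_self act_minus)
    then have "act (w \<otimes> s) g \<notin> P" if "g \<in> F" for g
      using w that s by (cases "g = ?r") (auto simp: cell_def act_right_gen)
    moreover have "act (w \<otimes> s) g \<in> P" if "g \<in> B" for g
      using w that s by (auto simp: cell_def act_right_gen)
    ultimately show "w \<otimes> s \<in> cell F B" using wc s by (auto simp: cell_def gen_closed)
  qed
  have "step (y \<otimes> s) (z \<otimes> s) \<or> z = y \<otimes> s"
    using lifting_right[OF s] yz(3) unfolding lifting_def by blast
  moreover have "z \<noteq> y \<otimes> s"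
    using mem(2)[OF yz(2)] yz s cell_closed[OF yz(1)] by (auto simp: gen_cancel)
  ultimately have "link (cell F B) (y \<otimes> s) (z \<otimes> s)"
    using mem[OF yz(1)] mem[OF yz(2)] yz(4) unfolding link_def by auto
  then show ?case by (rule rtranclp.rtrancl_into_rtrancl[OF step(3)])
qed simp

text \<open>If F contains a simple root, translate by its reflection: this removes a root from F and keeps the
size of \<open>F \<union> B\<close>. If F is nonempty but contains no simple root, then some element of F decomposes
as a + b with a in B; all elements of the cell make b negative, so b can be added to F, and with a
good choice of a and b the union remains coclosed. Once F is empty, \<open>lower_cell_chain\<close> applies.\<close>

lemma cell_chain:
  assumes "F \<subseteq> P" "B \<subseteq> P" "coclosed (F \<union> B)"
    and "x \<in> cell F B" "v \<in> cell F B" "x \<sqsubseteq> v"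
  shows "(link (cell F B))\<^sup>*\<^sup>* x v"
  using assms
\<comment> \<open>Adding a root to F lowers the first summand by two and raises the second by one.\<close>
proof (induction "2 * card (P - (F \<union> B)) + card F" arbitrary: F B x v rule: less_induct)
  case less
  note FB = less.prems(1,2) and co = less.prems(3) and mem = less.prems(4,5) and le = less.prems(6)
  have fin: "finite F" "finite B" using FB finite_P finite_subset by auto
  have xv: "x \<in> carrier G" "v \<in> carrier G" using mem cell_closed by auto
  have disj: "g \<notin> B" if "g \<in> F" for g using that mem(1) by (auto simp: cell_def)
  consider (empty) "F = {}" | (simple) s where "s \<in> S" "simple_root s \<in> F"
    | (composite) "F \<noteq> {}" "\<And>s. s \<in> S \<Longrightarrow> simple_root s \<notin> F" by blast
  then show ?case
  proof cases
    case empty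
    then show ?thesis using lower_cell_chain[of B x v] less.prems by simp
  next
    case (simple s)
    note s = simple(1)
    let ?r = "simple_root s"
    define F' where "F' = act s ` (F - {?r})"
    define B' where "B' = insert ?r (act s ` B)"
    have inj: "inj_on (act s) X" for X
      by (rule inj_on_inverseI[where g = "act s"]) (simp add: act_gen_twice[OF s])
    have rB: "?r \<notin> B" using disj simple by blast
    have F'B': "F' \<subseteq> P" "B' \<subseteq> P"
      using FB rB simple_perm[OF s] simple_in_P[OF s] unfolding F'_def B'_def by auto
    have U': "F' \<union> B' = insert ?r (act s ` ((F \<union> B) - {?r}))"
      using rB unfolding F'_def B'_def by auto
    have co': "coclosed (F' \<union> B')"
      unfolding U' by (rule coclosed_translate[OF co _ s]) (use FB in blast)
    have r_new: "?r \<notin> act s ` ((F \<union> B) - {?r})"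
    proof
      assume "?r \<in> act s ` ((F \<union> B) - {?r})"
      then obtain g where g: "g \<in> F \<union> B" "?r = act s g" by blast
      have "g = - ?r" using act_gen_twice[OF s, of g] act_gen_self[OF s] g(2) by simp
      then show False using g(1) FB not_both_pos[OF simple_in_P[OF s]] by blast
    qed
    have "card (F' \<union> B') = card (F \<union> B)"
    proof -
      have "card (F' \<union> B') = Suc (card (act s ` ((F \<union> B) - {?r})))"
        unfolding U' using r_new fin by simp
      also have "\<dots> = Suc (card ((F \<union> B) - {?r}))" by (simp add: card_image inj)
      also have "\<dots> = card (F \<union> B)" by (rule card_Suc_Diff1) (use fin simple in auto)
      finally show ?thesis .
    qed
    then have "card (P - (F' \<union> B')) = card (P - (F \<union> B))"
      using card_Diff_subset[of "F' \<union> B'" P] card_Diff_subset[of "F \<union> B" P] F'B' FB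
        finite_subset[OF _ finite_P] by simp
    moreover have "card F' < card F"
      unfolding F'_def using fin simple card_Diff1_less[of F ?r] by (simp add: card_image inj)
    ultimately have dec: "2 * card (P - (F' \<union> B')) + card F' < 2 * card (P - (F \<union> B)) + card F"
      by simp
    have mem': "z \<otimes> s \<in> cell F' B'" "len (z \<otimes> s) < len z" "z \<otimes> s \<otimes> s = z"
      if z: "z \<in> cell F B" for z
    proof -
      have zc: "z \<in> carrier G" "act z ?r \<notin> P" using z simple by (auto simp: cell_def)
      then show "z \<otimes> s \<otimes> s = z" using s by (simp add: gen_cancel)
      show "len (z \<otimes> s) < len z"
        using act_simple_pos[OF zc(1) s] zc(2) len_right[OF zc(1) s] by auto
      have "act (z \<otimes> s) ?r \<in> P"
        using zc s by (simp add: act_right_gen act_gen_self act_minus neg_in_P_iff act_root simple_in_R)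
      then show "z \<otimes> s \<in> cell F' B'"
        using z zc s unfolding F'_def B'_def
        by (auto simp: cell_def gen_closed act_right_gen act_gen_twice)
    qed
    have "x \<otimes> s \<sqsubseteq> v \<otimes> s" using lifting_both_down[OF lifting_right[OF s] le] mem' mem by blast
    then have "(link (cell F' B'))\<^sup>*\<^sup>* (x \<otimes> s) (v \<otimes> s)"
      using less.hyps[OF dec F'B' co'] mem' mem by blast
    from right_translate_chain[OF s simple(2) FB this[unfolded F'_def B'_def]]
    show ?thesis using mem' mem by simp
  next
    case composite
    obtain f where f: "f \<in> F" "\<And>g. g \<in> F \<Longrightarrow> ht f \<le> ht g"
      using ex_has_least_nat[of "\<lambda>f. f \<in> F" _ ht] composite(1) by blast
    then have fP: "f \<in> P" using FB by blast
    \<comment> \<open>The candidates for a. Greatest height ensures that no root a + c in B is a candidate as well.\<close>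
    define A where "A = {a \<in> B. \<exists>b\<in>P. a + b = f}"
    have lower: "c \<notin> F" if "c \<in> P" "d \<in> P" "c + d = f" for c d
    proof
      assume "c \<in> F"
      then have "ht (c + d) \<le> ht c" unfolding that(3) by (rule f(2))
      moreover have "ht (c + d) = ht c + ht d"
        by (rule ht_add[OF that(1,2)]) (simp only: that(3) fP)
      ultimately show False using ht_pos[OF that(2)] by simp
    qed
    have "A \<noteq> {}"
    proof (cases rule: simple_or_descends[OF fP])
      case (1 s)
      then show ?thesis using f(1) composite(2) by blast
    next
      case (2 s b)
      note sP = simple_in_P[OF 2(1)]
      have "b \<in> F \<union> B \<or> simple_root s \<in> F \<union> B"
        using co f(1) 2 sP unfolding coclosed_def by blast
      then have "b \<in> B \<or> simple_root s \<in> B"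
        using lower[OF 2(2) sP] composite(2)[OF 2(1)] 2(3) by blast
      moreover have "b + simple_root s = f" "simple_root s + b = f"
        using 2(3) by (simp_all add: add.commute)
      ultimately show ?thesis using 2(2) sP unfolding A_def by blast
    qed
    moreover have "finite A" unfolding A_def using fin by simp
    ultimately obtain a where a: "a \<in> A" "\<And>a'. a' \<in> A \<Longrightarrow> ht a' \<le> ht a"
    proof -
      assume A: "A \<noteq> {}" "finite A"
      then have "Max (ht ` A) \<in> ht ` A" by (intro Max_in) auto
      then obtain a where "a \<in> A" "ht a = Max (ht ` A)" by auto
      then show thesis using that[of a] A by simp
    qed
    then obtain b where ab: "a \<in> B" "a \<in> P" "b \<in> P" "a + b = f"
      using FB unfolding A_def by blast
    have neg: "act z b \<notin> P" if "z \<in> cell F B" for z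
      using act_sum_pos[of z a b] that ab f(1) fP P_in_R by (auto simp: cell_def)
    have eq: "cell (insert b F) B = cell F B" using neg by (auto simp: cell_def)
    have "b + a = f" using ab(4) by (simp add: add.commute)
    then have bU: "b \<notin> F \<union> B" using lower[OF ab(3,2)] neg[OF mem(1)] mem(1) by (auto simp: cell_def)
    have "coclosed (insert b (F \<union> B))"
    proof (rule coclosed_extend[OF co _ refl fP f(2) ab(2) _ ab(3,4)])
      show "f \<in> F \<union> B" using f(1) by blast
      show "ht a' \<le> ht a" if "a' \<in> B" "a' \<in> P" "b' \<in> P" "a' + b' = f" for a' b'
        using that a(2) unfolding A_def by blast
    qed
    then have co': "coclosed (insert b F \<union> B)" by simp
    have "P - (insert b F \<union> B) = (P - (F \<union> B)) - {b}" by blast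
    then have "card (P - (insert b F \<union> B)) < card (P - (F \<union> B))"
      using card_Diff1_less[of "P - (F \<union> B)" b] bU ab(3) finite_P by simp
    moreover have "card (insert b F) = Suc (card F)" using fin bU by simp
    ultimately have dec: "2 * card (P - (insert b F \<union> B)) + card (insert b F)
        < 2 * card (P - (F \<union> B)) + card F" by simp
    have "insert b F \<subseteq> P" using ab FB by blast
    from less.hyps[OF dec this FB(2) co'] show ?thesis using eq mem le by simp
  qed
qed

section \<open>The chain below a minimal reflection\<close>

text \<open>The elements of the chain are required to keep the signs that y has below a and on the summands of a.
By minimality and rigidity x has these signs too, and they suffice for the reflection of a to lead to a cover.\<close>

definition forced_neg :: "'a \<Rightarrow> ('a \<Rightarrow> real) \<Rightarrow> ('a \<Rightarrow> real) set" where
  "forced_neg y a = {g \<in> P. below g a \<and> act y g \<notin> P}"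

definition forced_pos :: "'a \<Rightarrow> ('a \<Rightarrow> real) \<Rightarrow> ('a \<Rightarrow> real) set" where
  "forced_pos y a = insert a {g \<in> P. act y g \<in> P \<and> (\<exists>h\<in>P. g + h = a)}"

abbreviation minimal_cell :: "'a \<Rightarrow> ('a \<Rightarrow> real) \<Rightarrow> 'a set" where
  "minimal_cell y a \<equiv> cell (forced_neg y a) (forced_pos y a)"

lemma below_add: "g \<in> P \<Longrightarrow> h \<in> P \<Longrightarrow> g + h = a \<Longrightarrow> below g a"
  using below_sum by blast

lemma below_trans: "below g h \<Longrightarrow> below h a \<Longrightarrow> below g a"
  unfolding below_def by (metis order.antisym order.trans ext)

text \<open>If y inverts a root b + c below a, it inverts b or c. All summands of a belong to the union. A decomposition b + c of a summand of a, with complementary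
summand h, has the property that h + b or h + c is a root, so that c or b is again a summand of a.\<close>

lemma forced_coclosed:
  assumes min: "minimal_inversion x y a"
  shows "coclosed (forced_neg y a \<union> forced_pos y a)" (is "coclosed ?U")
  unfolding coclosed_def
proof (intro ballI impI)
  fix b c assume bc: "b \<in> P" "c \<in> P" "b + c \<in> ?U"
  have a: "a \<in> P" "y \<in> carrier G" using min by (auto simp: minimal_inversion_def)
  have summand: "g \<in> ?U" if "g \<in> P" "h \<in> P" "g + h = a" for g h
    using that below_add[OF that] by (auto simp: forced_neg_def forced_pos_def)
  from bc(3) consider (neg) "b + c \<in> forced_neg y a" | (top) "b + c = a"
    | (pos) h where "b + c \<in> P" "h \<in> P" "(b + c) + h = a"
    by (auto simp: forced_pos_def)
  then show "b \<in> ?U \<or> c \<in> ?U"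
  proof cases
    case neg
    then have bc': "b + c \<in> P" "below (b + c) a" "act y (b + c) \<notin> P"
      by (auto simp: forced_neg_def)
    then have "act y b \<notin> P \<or> act y c \<notin> P" using act_sum_pos[of y b c] a bc P_in_R by blast
    moreover have "below b a" "below c a" using below_sum[OF bc(1,2)] below_trans bc'(2) by blast+
    ultimately show ?thesis using bc by (auto simp: forced_neg_def)
  next
    case top
    then show ?thesis using summand bc by blast
  next
    case pos
    have "ip h (b + c) = -1"
      using ip_of_summands[of h "b + c"] pos a P_in_R by (simp add: add.commute)
    then have "ip h b + ip h c = -1" unfolding ip_add_right .
    then have "ip h b < 0 \<or> ip h c < 0" by linarith
    moreover have "e \<in> ?U" if de: "d \<in> P" "e \<in> P" "d + e = b + c" "ip h d < 0" for d e
    proof -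
      have "h \<noteq> d" using de root_norm[of h] pos P_in_R by auto
      then have "ip h d = -1" using ip_cases_pos[OF pos(2) de(1)] de(4) by auto
      then have "h + d \<in> P" using sum_of_roots pos_add pos(2) de(1) P_in_R by blast
      moreover have "e + (h + d) = a"
        unfolding pos(3)[symmetric] de(3)[symmetric] by (simp add: ac_simps)
      ultimately show ?thesis using summand de(2) by blast
    qed
    ultimately show ?thesis using bc add.commute[of b c] by metis
  qed
qed

lemma source_in_minimal_cell:
  assumes min: "minimal_inversion x y a"
  shows "x \<in> minimal_cell y a"
proof -
  have "act x g \<in> P" if g: "g \<in> P" "act y g \<in> P" "h \<in> P" "g + h = a" for g h
    using summands_agree(1)[OF min g(1,3) g(4)[symmetric]] g(2) by blast
  then show ?thesis
    using min unfolding cell_def minimal_inversion_def forced_neg_def forced_pos_def by blast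
qed

text \<open>Under \<open>y \<otimes> rt a\<close> a root g has the sign of its reflection in a under y. This reflection is g itself,
minus the complementary summand of a, or g + a, according to the product of g with a.\<close>

lemma target_in_minimal_cell:
  assumes min: "minimal_inversion x y a"
  shows "y \<otimes> rt a \<in> minimal_cell y a"
proof -
  have y: "y \<in> carrier G" and a: "a \<in> P" "a \<in> R" "act y a \<in> R" "act y a \<notin> P"
    using min P_in_R act_root by (auto simp: minimal_inversion_def)
  have refl: "act (y \<otimes> rt a) g = act y (reflect a g)" for g
    using y a by (simp add: act_mult act_rt)
  have "act (y \<otimes> rt a) a \<in> P"
    using y a by (simp add: act_mult act_rt_self act_minus neg_in_P_iff)
  moreover have "act (y \<otimes> rt a) g \<in> P"
    if g: "g \<in> P" "act y g \<in> P" "h \<in> P" "g + h = a" for g h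
  proof -
    have "ip a g = 1"
      using ip_of_summands[of g h] root_norm[of g] g a P_in_R ip_add_left[of g h g] ip_sym[of g h] by simp
    then have "reflect a g = - h" unfolding reflect_def g(4)[symmetric] by (intro ext) simp
    moreover have "act y h \<notin> P" using summands_agree(2)[OF min g(1,3) g(4)[symmetric]] g(2) by blast
    ultimately show ?thesis
      using refl y g(3) P_in_R by (simp add: act_minus neg_in_P_iff act_root)
  qed
  moreover have "act (y \<otimes> rt a) g \<notin> P" if g: "g \<in> P" "below g a" "act y g \<notin> P" for g
  proof -
    have gR: "g \<in> R" "act y g \<in> R" using g y P_in_R act_root by auto
    consider "ip a g = 0" | "ip a g = 1" | "ip a g = -1"
      using ip_cases_pos[OF a(1) g(1)] g(2) unfolding below_def by auto
    then show ?thesis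
    proof cases
      case 1
      then have "reflect a g = g" by (intro ext) (simp add: reflect_def)
      then show ?thesis using refl g by simp
    next
      case 2
      then have r: "reflect a g = g - a" by (intro ext) (simp add: reflect_def)
      define h where "h = a - g"
      have gh: "g + h = a" "g - a = - h" unfolding h_def by simp_all
      have "h = - reflect a g" using r gh by simp
      then have "h \<in> R" using reflect_root[OF a(2) gR(1)] neg_root by simp
      moreover have "0 \<le> h u" for u using g(2) by (simp add: below_def h_def)
      ultimately have h: "h \<in> P" by (simp add: P_iff)
      then have "act y h \<in> P" using summands_agree(2)[OF min g(1) h gh(1)[symmetric]] g(3) by blast
      then show ?thesis using refl r gh(2) y not_both_pos[of "act y h"] by (simp add: act_minus)
    next
      case 3
      then have r: "reflect a g = g + a" by (intro ext) (simp add: reflect_def)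
      have "g + a \<in> R" using reflect_root[OF a(2) gR(1)] r by simp
      then show ?thesis using act_sum_neg[of y g a] refl r y gR a g by simp
    qed
  qed
  ultimately show ?thesis
    using y a unfolding cell_def forced_neg_def forced_pos_def by auto
qed

lemma minimal_cell_cover:
  assumes min: "minimal_inversion x y a" and z: "z \<in> minimal_cell y a"
  shows "step z (z \<otimes> rt a)" "len (z \<otimes> rt a) = Suc (len z)"
proof -
  have zc: "z \<in> carrier G" and a: "a \<in> P" "act z a \<in> P"
    using z min by (auto simp: cell_def forced_pos_def minimal_inversion_def)
  show "step z (z \<otimes> rt a)" using stepI[OF zc a] .
  have pos: "act z g \<in> P" if "g \<in> P" "h \<in> P" "a = g + h" "act y g \<in> P" for g h
    using z that unfolding cell_def forced_pos_def by blast
  have neg: "act z g \<notin> P" if "g \<in> P" "h \<in> P" "a = g + h" "act y g \<notin> P" for g h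
    using z that below_add[of g h a] unfolding cell_def forced_neg_def by blast
  have "splits z a"
    unfolding splits_def
  proof (intro ballI impI)
    fix b c assume bc: "b \<in> P" "c \<in> P" "a = b + c"
    then have cb: "a = c + b" by (simp add: add.commute)
    show "act z b \<in> P \<longleftrightarrow> act z c \<notin> P"
      using summands_agree(2)[OF min bc] pos[OF bc] neg[OF bc] pos[OF bc(2,1) cb] neg[OF bc(2,1) cb]
      by blast
  qed
  then show "len (z \<otimes> rt a) = Suc (len z)" using splits_cover[OF zc a] by blast
qed

text \<open>The two translates still differ by a reflection, namely by the conjugate of the old one.\<close>

lemma step_translate:
  assumes "step z w" "a \<in> R" "len (z \<otimes> rt a) < len (w \<otimes> rt a)"
  shows "step (z \<otimes> rt a) (w \<otimes> rt a)"
proof -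
  obtain c where c: "z \<in> carrier G" "c \<in> P" "w = z \<otimes> rt c" using assms(1) by (rule stepE)
  have cR: "c \<in> R" using c P_in_R by blast
  let ?d = "act (rt a) c"
  have "act (rt a) (act (rt a) c) = c"
    using assms(2) by (simp add: act_rt reflect_involution root_norm)
  then have "rt a \<otimes> rt ?d = rt c \<otimes> rt a"
    using rt_move[of "rt a" ?d] assms(2) cR by (simp add: act_root)
  then have "w \<otimes> rt a = z \<otimes> rt a \<otimes> rt ?d"
    using c cR assms(2) by (simp add: m_assoc act_root)
  then show ?thesis
    unfolding bruhat_step_def using assms c cR rt_in_reflections[of ?d] by (auto simp: act_root)
qed

lemma minimal_inversion_chain:
  assumes le: "x \<sqsubseteq> y" and min: "minimal_inversion x y a"
  defines "n \<equiv> len y - len x - 1"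
  obtains z :: "nat \<Rightarrow> 'a" where "z 0 = x" "z n = y \<otimes> rt a"
    "\<And>i. i < n \<Longrightarrow> step (z i) (z (Suc i)) \<and> len (z (Suc i)) = Suc (len (z i))"
    "\<And>i. i \<le> n \<Longrightarrow> step (z i) (z i \<otimes> rt a) \<and> len (z i \<otimes> rt a) = Suc (len (z i))"
    "\<And>i. i \<le> n \<Longrightarrow> x \<sqsubseteq> z i \<and> z i \<otimes> rt a \<sqsubseteq> y"
proof -
  let ?K = "minimal_cell y a"
  have y: "y \<in> carrier G" and a: "a \<in> P" "a \<in> R" using min P_in_R by (auto simp: minimal_inversion_def)
  have "(link ?K)\<^sup>*\<^sup>* x (y \<otimes> rt a)"
    using generalized_lifting[OF le min] source_in_minimal_cell[OF min] target_in_minimal_cell[OF min]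
      forced_coclosed[OF min] a
    by (intro cell_chain) (auto simp: forced_neg_def forced_pos_def)
  then obtain m where "(link ?K ^^ m) x (y \<otimes> rt a)" using rtranclp_imp_relpowp by metis
  then obtain z where z: "z 0 = x" "z m = y \<otimes> rt a" "\<And>i. i < m \<Longrightarrow> link ?K (z i) (z (Suc i))"
    unfolding relpowp_fun_conv by blast
  have len: "len (z i) = len x + i" if "i \<le> m" for i
    using that by (induction i) (use z in \<open>auto simp: link_def\<close>)
  have K: "z i \<in> ?K" if "i \<le> m" for i
    using that z source_in_minimal_cell[OF min]
    by (cases i) (auto simp: link_def Suc_le_eq)
  note cover = minimal_cell_cover[OF min K]
  have x_le: "x \<sqsubseteq> z i" if "i \<le> m" for i
    using that
  proof (induction i)
    case 0
    then show ?case using z le_refl[OF le_closed(1)[OF le]] by simp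
  next
    case (Suc i)
    then show ?case using z(3)[of i] le_trans step_le by (auto simp: link_def)
  qed
  have le_y: "z i \<otimes> rt a \<sqsubseteq> y" if "i \<le> m" for i
    using that
  proof (induction rule: inc_induct)
    case base
    then show ?case using z y a le_refl by (simp add: rt_cancel)
  next
    case (step i)
    have "step (z i) (z (Suc i))" using z(3)[OF step(2)] by (simp add: link_def)
    moreover have "len (z i \<otimes> rt a) < len (z (Suc i) \<otimes> rt a)"
      using cover(2)[of i] cover(2)[of "Suc i"] len[of i] len[of "Suc i"] step(2) by simp
    ultimately show ?case using step_translate[OF _ a(2)] step_le le_trans step(3) by blast
  qed
  have "len y = Suc (len x + m)"
    using cover(2)[of m] len[of m] z y a by (simp add: rt_cancel)
  then have "m = n" by (simp add: n_def)
  then show ?thesis using that[of z] z cover x_le le_y by (auto simp: link_def)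
qed

lemma refl_root_rt:
  assumes a: "a \<in> P"
  shows "refl_root G S (rt a) = a"
  unfolding refl_root_def
proof (rule the_equality)
  have less: "bruhat_less G S w (w \<otimes> s) \<longleftrightarrow> act w (simple_root s) \<in> P"
    if "w \<in> carrier G" "s \<in> S" for w s
    using less_rt_iff[OF that(1) simple_in_P[OF that(2)]] that by (simp add: rt_simple)
  obtain w s where "w \<in> carrier G" "s \<in> S" "a = act w (simple_root s)"
    using a P_in_R rootE by blast
  then show "a \<in> P \<and> (\<exists>w\<in>carrier G. \<exists>s\<in>S. rt a = w \<otimes> s \<otimes> inv w \<and>
      bruhat_less G S w (w \<otimes> s) \<and> a = act w (simple_root s))"
    using a less rt_conj by blast
next
  fix b assume b: "b \<in> P \<and> (\<exists>w\<in>carrier G. \<exists>s\<in>S. rt a = w \<otimes> s \<otimes> inv w \<and>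
      bruhat_less G S w (w \<otimes> s) \<and> b = act w (simple_root s))"
  then have "rt b = rt a" using rt_conj by auto
  then show "b = a" using rt_inj b a by blast
qed

lemma root_less_iff:
  assumes "g \<in> R" "a \<in> R"
  shows "root_less S g a \<longleftrightarrow> below g a"
proof -
  have sum: "(\<Sum>s\<in>S. c s * simple_root s u) = (if u \<in> S then c u else 0)" for c u
  proof -
    have "(\<Sum>s\<in>S. c s * simple_root s u) = (\<Sum>s\<in>S. if s = u then c s else 0)"
      by (intro sum.cong refl) (auto simp: simple_root_def)
    then show ?thesis using finite_gens by simp
  qed
  show ?thesis
  proof
    assume "root_less S g a"
    then obtain c where c: "a \<noteq> g" "\<forall>s\<in>S. 0 \<le> c s"
        "\<And>u. a u - g u = (if u \<in> S then c u else 0)"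
      unfolding root_less_def sum by blast
    have "g u \<le> a u" for u using c(2) c(3)[of u] by (auto split: if_splits)
    then show "below g a" using c(1) by (simp add: below_def)
  next
    assume "below g a"
    then have b: "g \<noteq> a" "\<And>u. g u \<le> a u" by (auto simp: below_def)
    then show "root_less S g a"
      unfolding root_less_def sum using root_coord(2)[OF assms(1)] root_coord(2)[OF assms(2)]
      by (intro conjI exI[of _ "\<lambda>u. a u - g u"]) auto
  qed
qed

lemma AD_rt_iff:
  assumes "x \<in> carrier G" "y \<in> carrier G" "a \<in> P"
  shows "rt a \<in> AD G S x y \<longleftrightarrow> act x a \<in> P \<and> act y a \<notin> P"
  unfolding AD_def using less_rt_iff[OF assms(1,3)] rt_less_iff[OF assms(2,3)]
    rt_in_reflections[OF P_in_R[OF assms(3)]] by blast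

lemma minimal_reflectionE:
  assumes "minimal_reflection G S x y t" "x \<in> carrier G" "y \<in> carrier G"
  obtains a where "t = rt a" "minimal_inversion x y a"
proof -
  have t: "t \<in> AD G S x y" and min: "\<And>r. r \<in> AD G S x y \<Longrightarrow> \<not> refl_less G S r t"
    using assms by (auto simp: minimal_reflection_def)
  obtain a where a: "a \<in> P" "t = rt a" using t reflectionE unfolding AD_def by blast
  have "act x g \<notin> P" if g: "g \<in> P" "below g a" "act y g \<notin> P" for g
  proof
    assume "act x g \<in> P"
    then have "rt g \<in> AD G S x y" using AD_rt_iff[OF assms(2,3) g(1)] g(3) by simp
    moreover have "refl_less G S (rt g) t"
      unfolding refl_less_def a(2) refl_root_rt[OF g(1)] refl_root_rt[OF a(1)]
      using root_less_iff[OF P_in_R[OF g(1)] P_in_R[OF a(1)]] g(2) by simp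
    ultimately show False using min by blast
  qed
  then have "minimal_inversion x y a"
    using a t assms(2,3) AD_rt_iff[OF assms(2,3) a(1)] by (simp add: minimal_inversion_def)
  then show ?thesis using that a by blast
qed

end

theorem proposition5p7:
  fixes G :: "('a, 'b) monoid_scheme" and S :: "'a set" and x y t :: 'a
  assumes "coxeter_system G S"
    and "finite (carrier G)"
    and "simply_laced G S"
    and "bruhat_less G S x y"
    and "minimal_reflection G S x y t"
  shows "\<exists>z :: nat \<Rightarrow> 'a.
    z 0 = x \<and> z (cox_length G S y - cox_length G S x - 1) = y \<otimes>\<^bsub>G\<^esub> t \<and>
    (\<forall>i < cox_length G S y - cox_length G S x - 1. bruhat_cover G S (z i) (z (Suc i))) \<and>
    (\<forall>i \<le> cox_length G S y - cox_length G S x - 1.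
       z i \<otimes>\<^bsub>G\<^esub> t \<in> bruhat_interval G S x y \<and> bruhat_cover G S (z i) (z i \<otimes>\<^bsub>G\<^esub> t))"
proof -
  interpret simply_laced_coxeter G S using assms(1-3) by unfold_locales
  have le: "bruhat_le G S x y" using assms(4) by (simp add: bruhat_less_def)
  obtain a where a: "t = rt a" "minimal_inversion x y a"
    using minimal_reflectionE[OF assms(5)] le_closed[OF le] by blast
  let ?n = "cox_length G S y - cox_length G S x - 1"
  obtain z where z: "z 0 = x" "z ?n = y \<otimes>\<^bsub>G\<^esub> t"
    and up: "\<And>i. i < ?n \<Longrightarrow> bruhat_step G S (z i) (z (Suc i)) \<and>
        cox_length G S (z (Suc i)) = Suc (cox_length G S (z i))"
    and across: "\<And>i. i \<le> ?n \<Longrightarrow> bruhat_step G S (z i) (z i \<otimes>\<^bsub>G\<^esub> t) \<and>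
        cox_length G S (z i \<otimes>\<^bsub>G\<^esub> t) = Suc (cox_length G S (z i))"
    and between: "\<And>i. i \<le> ?n \<Longrightarrow> bruhat_le G S x (z i) \<and> bruhat_le G S (z i \<otimes>\<^bsub>G\<^esub> t) y"
    using minimal_inversion_chain[OF le a(2)] unfolding a(1) by blast
  have cover: "bruhat_cover G S u v"
    if "bruhat_step G S u v \<and> cox_length G S v = Suc (cox_length G S u)" for u v
    using that step_le[of u v] unfolding bruhat_cover_def bruhat_less_def by auto
  show ?thesis
  proof (intro exI[of _ z] conjI allI impI)
    fix i assume i: "i \<le> ?n"
    show "bruhat_cover G S (z i) (z i \<otimes>\<^bsub>G\<^esub> t)" by (rule cover[OF across[OF i]])
    have "bruhat_le G S (z i) (z i \<otimes>\<^bsub>G\<^esub> t)" using across[OF i] step_le by blast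
    then show "z i \<otimes>\<^bsub>G\<^esub> t \<in> bruhat_interval G S x y"
      using between[OF i] le_trans[of x "z i"] unfolding bruhat_interval_def by simp
  qed (use z cover[OF up] in simp_all)
qed

end
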